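(* Let $m\ge 1$ be an integer, $\nu\in(0,1]$, $\underline{\lambda}=(\lambda_1,\ldots,\lambda_m)\in(0,\infty)^m$, and let $\{\underline{M}^\nu(t):t\ge 0\}$ be the multivariate alternative fractional Poisson process with parameters $\nu$ and $\underline{\lambda}$. Let $C=(c_{jk}^{(\nu)})_{j,k\in\{1,\ldots,m\}}$ be the matrix $$c_{jk}^{(\nu)}:=\begin{cases} \frac{1}{\nu}\left(\frac{1}{\nu}-1\right)(s(\underline{\lambda}))^{1/\nu-2}\lambda_j\lambda_k & \text{if } j\ne k,\\ \frac{1}{\nu}\left(\frac{1}{\nu}-1\right)(s(\underline{\lambda}))^{1/\nu-2}\lambda_j^2+\frac{1}{\nu}(s(\underline{\lambda}))^{1/\nu-1}\lambda_j & \text{if } j=k, \end{cases}$$ and let $\tilde{\Lambda}(\underline{\theta}):=\frac{1}{2}\langle\underline{\theta},C\underline{\theta}\rangle$ for $\underline{\theta}\in\mathbb{R}^m$. Then, for every family of positive numbers $\{a_t:t>0\}$ such that $$a_t\to 0\quad\text{and}\quad ta_t\to\infty\quad\text{as } t\to\infty,$$ the family of random variables $$\left\{\sqrt{ta_t}\cdot\frac{\underline{M}^\nu(t)-\mathbb{E}[\underline{M}^\nu(t)]}{t}:t>0\right\}$$ satisfies, as $t\to\infty$, the large deviation principle on $\mathbb{R}^m$ with speed $1/a_t$ and good rate function $\tilde{\Lambda}^*$ defined by $$\tilde{\Lambda}^*(\underline{x}):=\sup_{\underline{\theta}\in\mathbb{R}^m}\{\langle\underline{\theta},\underline{x}\rangle-\tilde{\Lambda}(\underline{\theta})\},\qquad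 \underline{x}\in\mathbb{R}^m.$$
   Context: Notation: for $\underline{x},\underline{y}\in\mathbb{R}^m$, $s(\underline{x})=\sum_{i=1}^m x_i$ and $\langle\underline{x},\underline{y}\rangle=\sum_{i=1}^m x_iy_i$. Mittag-Leffler function: $E_{\alpha,\beta}(x):=\sum_{r\ge 0}\frac{x^r}{\Gamma(\alpha r+\beta)}$. Multivariate alternative fractional Poisson process with parameters $\nu$ and $\underline{\lambda}$: a process $\underline{M}^\nu(t)=(M_1^\nu(t),\ldots,M_m^\nu(t))$, $t\ge 0$, with values in $\{0,1,2,\ldots\}^m$, whose one-dimensional (fixed $t$) distributions are $$P(\underline{M}^\nu(t)=\underline{k})=\frac{(s(\underline{k}))!}{k_1!\cdots k_m!}\prod_{i=1}^m\lambda_i^{k_i}\cdot\frac{(t^\nu)^{s(\underline{k})}}{\Gamma(\nu s(\underline{k})+1)}\cdot\frac{1}{E_{\nu,1}(s(\underline{\lambda})t^\nu)}\quad\text{for all integers } k_1,\ldots,k_m\ge 0.$$ Equivalently, given the sum $s(\underline{M}^\nu(t))$, the vector is multinomial with probabilities $\lambda_i/s(\underline{\lambda})$, and $P(s(\underline{M}^\nu(t))=h)=\frac{(s(\underline{\lambda})t^\nu)^h}{\Gamma(\nu h+1)E_{\nu,1}(s(\underline{\lambda})t^\nu)}$ for integers $h\ge0$. Only these fixed-time distributions are relevant. The expectation $\mathbb{E}[\underline{M}^\nu(t)]$ is taken componentwise. Large deviation principle: let $\mathcal{Z}$ be a Hausdorff topological space with its Borel $\sigma$-algebra. A rate function is a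 lower semi-continuous $I:\mathcal{Z}\to[0,\infty]$; it is good if all level sets $\{z\in\mathcal{Z}:I(z)\le\gamma\}$, $\gamma\ge 0$, are compact. If $v_t\to\infty$ as $t\to\infty$, a family of $\mathcal{Z}$-valued random variables $\{Z_t:t>0\}$ satisfies the large deviation principle (as $t\to\infty$) with speed $v_t$ and rate function $I$ if $\limsup_{t\to\infty}\frac{1}{v_t}\log P(Z_t\in F)\le-\inf_{z\in F}I(z)$ for all closed $F$ and $\liminf_{t\to\infty}\frac{1}{v_t}\log P(Z_t\in G)\ge-\inf_{z\in G}I(z)$ for all open $G$. *)

theory Defs
  imports "HOL-Probability.Probability"
begin

section \<open>Vectors and the Mittag-Leffler function\<close>

definition vsum :: "'a::comm_monoid_add ^ 'm::finite \<Rightarrow> 'a"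
  where "vsum x = (\<Sum>i\<in>UNIV. x $ i)"

definition real_vec :: "nat ^ 'm \<Rightarrow> real ^ 'm"
  where "real_vec k = (\<chi> i. real (k $ i))"

text \<open>\<open>Gamma\<close> is \<open>0\<close> at its poles and \<open>x / 0 = 0\<close>, so at a pole the summand vanishes, in
  agreement with the convention \<open>1 / \<Gamma> = 0\<close> there.\<close>

definition mittag_leffler :: "real \<Rightarrow> real \<Rightarrow> real \<Rightarrow> real"
  where "mittag_leffler \<alpha> \<beta> x = (\<Sum>r. x ^ r / Gamma (\<alpha> * real r + \<beta>))"


section \<open>The multivariate alternative fractional Poisson process\<close>

text \<open>Only the one-dimensional (fixed time) distributions are prescribed; nothing is required
  of the joint laws at different times.\<close>

definition alt_frac_poisson_pmf :: "real \<Rightarrow> real ^ 'm::finite \<Rightarrow> real \<Rightarrow> nat ^ 'm \<Rightarrow> real"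
  where "alt_frac_poisson_pmf \<nu> lam t k =
    fact (vsum k) / (\<Prod>i\<in>UNIV. fact (k $ i)) * (\<Prod>i\<in>UNIV. (lam $ i) ^ (k $ i))
    * ((t powr \<nu>) ^ vsum k / Gamma (\<nu> * real (vsum k) + 1))
    * (1 / mittag_leffler \<nu> 1 (vsum lam * t powr \<nu>))"

definition alt_frac_poisson_process ::
    "'w measure \<Rightarrow> real \<Rightarrow> real ^ 'm::finite \<Rightarrow> (real \<Rightarrow> 'w \<Rightarrow> nat ^ 'm) \<Rightarrow> bool"
  where "alt_frac_poisson_process P \<nu> lam M \<longleftrightarrow> prob_space P \<and>
    (\<forall>t\<ge>0. M t \<in> measurable P (count_space UNIV) \<and>
      (\<forall>k. \<P>(\<omega> in P. M t \<omega> = k) = alt_frac_poisson_pmf \<nu> lam t k))"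

definition mean_vec :: "'w measure \<Rightarrow> ('w \<Rightarrow> nat ^ 'm) \<Rightarrow> real ^ 'm"
  where "mean_vec P X = (\<chi> i. integral\<^sup>L P (\<lambda>\<omega>. real (X \<omega> $ i)))"


section \<open>Large deviation principle\<close>

definition lower_semicontinuous :: "('z::topological_space \<Rightarrow> ereal) \<Rightarrow> bool"
  where "lower_semicontinuous I \<longleftrightarrow> (\<forall>c. closed {z. I z \<le> c})"

definition rate_function :: "('z::t2_space \<Rightarrow> ereal) \<Rightarrow> bool"
  where "rate_function I \<longleftrightarrow> (\<forall>z. 0 \<le> I z) \<and> lower_semicontinuous I"

definition good_rate_function :: "('z::t2_space \<Rightarrow> ereal) \<Rightarrow> bool"
  where "good_rate_function I \<longleftrightarrow>
    rate_function I \<and> (\<forall>\<gamma>::real. 0 \<le> \<gamma> \<longrightarrow> compact {z. I z \<le> ereal \<gamma>})"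

text \<open>The logarithm with \<open>log 0 = -\<infinity>\<close>; the library's real \<open>ln\<close> has \<open>ln 0 = 0\<close>.\<close>

definition log_prob :: "real \<Rightarrow> ereal"
  where "log_prob p = (if p = 0 then -\<infinity> else ereal (ln p))"

definition satisfies_LDP ::
    "'w measure \<Rightarrow> (real \<Rightarrow> 'w \<Rightarrow> 'z::t2_space) \<Rightarrow> (real \<Rightarrow> real) \<Rightarrow> ('z \<Rightarrow> ereal) \<Rightarrow> bool"
  where "satisfies_LDP P Z v I \<longleftrightarrow>
    prob_space P \<and> (\<forall>t>0. Z t \<in> borel_measurable P) \<and>
    filterlim v at_top at_top \<and> rate_function I \<and>
    (\<forall>F. closed F \<longrightarrow>
      Limsup at_top (\<lambda>t. ereal (1 / v t) * log_prob \<P>(\<omega> in P. Z t \<omega> \<in> F)) \<le> - (INF z\<in>F. I z)) \<and>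
    (\<forall>G. open G \<longrightarrow>
      - (INF z\<in>G. I z) \<le> Liminf at_top (\<lambda>t. ereal (1 / v t) * log_prob \<P>(\<omega> in P. Z t \<omega> \<in> G)))"


section \<open>The limiting quadratic form and its Legendre transform\<close>

definition cov_matrix :: "real \<Rightarrow> real ^ 'm::finite \<Rightarrow> real ^ 'm ^ 'm"
  where "cov_matrix \<nu> lam = (\<chi> j k.
    if j \<noteq> k
    then 1 / \<nu> * (1 / \<nu> - 1) * vsum lam powr (1 / \<nu> - 2) * (lam $ j) * (lam $ k)
    else 1 / \<nu> * (1 / \<nu> - 1) * vsum lam powr (1 / \<nu> - 2) * (lam $ j)\<^sup>2
         + 1 / \<nu> * vsum lam powr (1 / \<nu> - 1) * (lam $ j))"

definition Lambda_tilde :: "real \<Rightarrow> real ^ 'm::finite \<Rightarrow> real ^ 'm \<Rightarrow> real"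
  where "Lambda_tilde \<nu> lam \<theta> = 1 / 2 * (\<theta> \<bullet> (cov_matrix \<nu> lam *v \<theta>))"

definition legendre_transform :: "('a::real_inner \<Rightarrow> real) \<Rightarrow> 'a \<Rightarrow> ereal"
  where "legendre_transform f x = (SUP \<theta>. ereal (\<theta> \<bullet> x - f \<theta>))"

end

theory Submission
  imports Defs
begin

text \<open>
  With \<open>\<epsilon> = 1 / sqrt (t * a t)\<close>, the logarithmic moment generating function of the rescaled process at
  speed \<open>1 / a t\<close> is \<open>a t * (l t \<epsilon> - \<epsilon> * m t)\<close>, where \<open>l t\<close> is the logarithmic moment generating
  function of \<open>\<theta> \<bullet> M t\<close> and \<open>m t\<close> its mean. Once this is shown to converge to \<open>Lambda_tilde\<close>, which is
  differentiable with a surjective gradient, the Gaertner-Ellis theorem gives the claim.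

  The limit comes from an exact formula. Tilting the weights, \<open>\<lambda>\<^sub>i \<mapsto> \<lambda>\<^sub>i * exp \<theta>\<^sub>i\<close>, and summing with the
  multinomial theorem expresses the moment generating function as a quotient of two Mittag-Leffler
  values (\<open>alt_frac_poisson_mgf\<close>). Since \<open>ln (E\<^bsub>\<nu>,1\<^esub> z) = z powr (1 / \<nu>) + O(1)\<close>
  (\<open>ln_mittag_leffler_asymp\<close>), it follows that \<open>l t x = t * (\<psi> x - \<psi> 0) + O(1)\<close> with
  \<open>\<psi> x = (\<Sum>i. \<lambda>\<^sub>i * exp (x * \<theta>\<^sub>i)) powr (1 / \<nu>)\<close>. The factor \<open>a t\<close> kills the bounded error, and because
  \<open>t * a t * \<epsilon>\<^sup>2 = 1\<close> exactly the second-order Taylor coefficient of \<open>\<psi>\<close> at \<open>0\<close> survives, which is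
  \<open>Lambda_tilde \<nu> \<lambda> \<theta>\<close>. The centring must be the true mean rather than \<open>t\<close> times the derivative of \<open>\<psi>\<close>;
  Jensen's inequality \<open>x * m t \<le> l t x\<close> at \<open>x = \<plusminus> 1 / sqrt t\<close> shows that the two differ by
  \<open>O(sqrt t)\<close>, which is negligible on the moderate scale (\<open>moderate_scaling_of_log_mgf\<close>).

  In the Gaertner-Ellis theorem the upper bound is Chernoff's inequality on half-spaces together with
  compactness. For the lower bound at \<open>x\<close>, let \<open>x\<close> be the gradient of the limit at \<open>\<eta>\<close>: under the exponential tilt by
  \<open>\<eta>\<close> the mass outside any cube around \<open>x\<close> is exponentially small, by the same Chernoff
  inequality in the finitely many coordinate directions, so almost all of the tilted mass sits near
  \<open>x\<close>, where the tilting density is known up to a small exponential factor.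
\<close>


section \<open>Large deviations from the limiting logarithmic moment generating function\<close>

lemma legendre_transform_ge: "ereal (\<theta> \<bullet> x - f \<theta>) \<le> legendre_transform f x"
  unfolding legendre_transform_def by (rule SUP_upper) simp

lemma legendre_transform_sublevel_closed: "closed {x. legendre_transform f x \<le> c}"
proof -
  have "{x. legendre_transform f x \<le> c} = (\<Inter>\<theta>. {x. ereal (\<theta> \<bullet> x - f \<theta>) \<le> c})"
    by (auto simp: legendre_transform_def SUP_le_iff)
  also have "closed \<dots>"
    by (intro closed_INT ballI closed_Collect_le continuous_intros)
  finally show ?thesis .
qed

text \<open>Testing with the unit vectors \<open>\<plusminus> b\<close> bounds every coordinate on a sublevel set, so finiteness of
  \<open>f\<close> is what makes the rate function good.\<close>

lemma legendre_transform_good_rate_function: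
  fixes f :: "'a::euclidean_space \<Rightarrow> real"
  assumes "f 0 = 0"
  shows "good_rate_function (legendre_transform f)"
proof -
  have "0 \<le> legendre_transform f x" for x
    using legendre_transform_ge[of 0 x f] assms by (simp add: zero_ereal_def)
  moreover have "compact {x. legendre_transform f x \<le> ereal \<gamma>}" for \<gamma>
  proof -
    define R where "R = (\<Sum>b\<in>Basis. \<bar>\<gamma> + f b\<bar> + \<bar>\<gamma> + f (- b)\<bar>)"
    have "norm x \<le> R" if "legendre_transform f x \<le> ereal \<gamma>" for x
    proof -
      have le: "\<theta> \<bullet> x \<le> \<gamma> + f \<theta>" for \<theta>
        using order_trans[OF legendre_transform_ge that, of \<theta>] by simp
      have "\<bar>x \<bullet> b\<bar> \<le> \<bar>\<gamma> + f b\<bar> + \<bar>\<gamma> + f (- b)\<bar>" for b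
        using le[of b] le[of "- b"] unfolding inner_commute[of x b] inner_minus_left by linarith
      then show ?thesis
        unfolding R_def using norm_le_l1[of x] by (meson order_trans sum_mono)
    qed
    then have "bounded {x. legendre_transform f x \<le> ereal \<gamma>}" by (auto intro: boundedI)
    then show ?thesis by (simp add: compact_eq_bounded_closed legendre_transform_sublevel_closed)
  qed
  ultimately show ?thesis
    by (simp add: good_rate_function_def rate_function_def lower_semicontinuous_def
        legendre_transform_sublevel_closed)
qed


text \<open>The statement \<open>limsup (1 / v t) * ln (measure P (A t)) \<le> - c\<close>, phrased with eventual inequalities:
  this avoids logarithms of zero and is visibly stable under finite unions.\<close>

definition decay_rate :: "'w measure \<Rightarrow> (real \<Rightarrow> 'w set) \<Rightarrow> (real \<Rightarrow> real) \<Rightarrow> real \<Rightarrow> bool"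
  where "decay_rate P A v c \<longleftrightarrow>
    (\<forall>c'<c. \<forall>\<^sub>F t in at_top. measure P (A t) \<le> exp (- c' * v t))"

text \<open>A union of \<open>N\<close> sets costs a factor \<open>N\<close>, which any loss \<open>exp ((d - c') * v t)\<close> in the exponent
  absorbs.\<close>

lemma decay_rate_finite_UN:
  assumes "prob_space P" and v: "filterlim v at_top at_top" and "finite I"
    and A: "\<And>i. i \<in> I \<Longrightarrow> decay_rate P (A i) v c"
    and meas: "\<And>i. i \<in> I \<Longrightarrow> \<forall>\<^sub>F t in at_top. A i t \<in> sets P"
  shows "decay_rate P (\<lambda>t. \<Union>i\<in>I. A i t) v c"
  unfolding decay_rate_def
proof (intro allI impI)
  interpret prob_space P by fact
  fix c' assume "c' < c"
  then obtain d where d: "c' < d" "d < c" using dense by blast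
  have "\<forall>\<^sub>F t in at_top. \<forall>i\<in>I. A i t \<in> sets P \<and> measure P (A i t) \<le> exp (- d * v t)"
    using A meas d \<open>finite I\<close>
    by (intro eventually_ball_finite ballI eventually_conj) (auto simp: decay_rate_def)
  moreover have "\<forall>\<^sub>F t in at_top. ln (1 + real (card I)) / (d - c') \<le> v t"
    using v by (simp add: filterlim_at_top)
  ultimately show "\<forall>\<^sub>F t in at_top. measure P (\<Union>i\<in>I. A i t) \<le> exp (- c' * v t)"
  proof eventually_elim
    case (elim t)
    have "measure P (\<Union>i\<in>I. A i t) \<le> (\<Sum>i\<in>I. measure P (A i t))"
      using elim \<open>finite I\<close> by (intro finite_measure_subadditive_finite) auto
    also have "\<dots> \<le> real (card I) * exp (- d * v t)"
      using elim by (intro sum_bounded_above) auto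
    also have "\<dots> \<le> exp (ln (1 + real (card I))) * exp (- d * v t)"
      by (intro mult_right_mono) auto
    also have "ln (1 + real (card I)) \<le> (d - c') * v t"
      using elim d by (simp add: pos_divide_le_eq mult.commute)
    then have "exp (ln (1 + real (card I))) * exp (- d * v t) \<le> exp ((d - c') * v t) * exp (- d * v t)"
      by (simp only: exp_le_cancel_iff mult_right_mono exp_ge_zero)
    also have "\<dots> = exp (- c' * v t)" by (simp add: mult_exp_exp algebra_simps)
    finally show ?case .
  qed
qed

lemma decay_rate_mono:
  assumes "prob_space P" "decay_rate P B v c" "\<And>t. 0 < t \<Longrightarrow> A t \<subseteq> B t"
    "\<And>t. 0 < t \<Longrightarrow> B t \<in> sets P"
  shows "decay_rate P A v c"
  unfolding decay_rate_def
proof (intro allI impI)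
  interpret prob_space P by fact
  fix c' assume "c' < c"
  then have "\<forall>\<^sub>F t in at_top. measure P (B t) \<le> exp (- c' * v t)"
    using assms by (auto simp: decay_rate_def)
  moreover have "\<forall>\<^sub>F t in at_top. (0::real) < t" by (rule eventually_gt_at_top)
  ultimately show "\<forall>\<^sub>F t in at_top. measure P (A t) \<le> exp (- c' * v t)"
    by eventually_elim (meson assms(3,4) finite_measure_mono order_trans)
qed

lemma Limsup_log_prob_le:
  assumes c: "decay_rate P A v c" and v: "\<And>t. 0 < t \<Longrightarrow> 0 < v t"
  shows "Limsup at_top (\<lambda>t. ereal (1 / v t) * log_prob (measure P (A t))) \<le> ereal (- c)"
proof (rule ereal_le_epsilon2)
  fix e :: real assume e: "0 < e"
  have "\<forall>\<^sub>F t in at_top. measure P (A t) \<le> exp (- (c - e) * v t)"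
    using c[unfolded decay_rate_def, THEN spec, of "c - e"] e by simp
  then have "\<forall>\<^sub>F t in at_top. ereal (1 / v t) * log_prob (measure P (A t)) \<le> ereal (- (c - e))"
    using eventually_gt_at_top[of "0::real"]
  proof eventually_elim
    case (elim t)
    show ?case
    proof (cases "measure P (A t) = 0")
      case True
      then show ?thesis using v[of t] elim by (simp add: log_prob_def)
    next
      case False
      then have "measure P (A t) > 0" by (simp add: zero_less_measure_iff)
      then have "ln (measure P (A t)) \<le> - (c - e) * v t"
        using elim by (metis exp_gt_zero ln_exp ln_le_cancel_iff)
      then show ?thesis using False v[of t] elim by (simp add: log_prob_def field_simps)
    qed
  qed
  then have "Limsup at_top (\<lambda>t. ereal (1 / v t) * log_prob (measure P (A t))) \<le> ereal (- (c - e))"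
    by (rule Limsup_bounded)
  then show "Limsup at_top (\<lambda>t. ereal (1 / v t) * log_prob (measure P (A t))) \<le> ereal (- c) + ereal e"
    by simp
qed

lemma Liminf_log_prob_ge:
  fixes v :: "real \<Rightarrow> real"
  assumes A: "\<And>e. 0 < e \<Longrightarrow> \<forall>\<^sub>F t in at_top. exp ((c - e) * v t) \<le> measure P (A t)"
    and v: "\<And>t. 0 < t \<Longrightarrow> 0 < v t"
  shows "ereal c \<le> Liminf at_top (\<lambda>t. ereal (1 / v t) * log_prob (measure P (A t)))"
proof (rule ereal_le_epsilon2)
  fix e :: real assume e: "0 < e"
  have "\<forall>\<^sub>F t in at_top. ereal (c - e) \<le> ereal (1 / v t) * log_prob (measure P (A t))"
    using A[OF e] eventually_gt_at_top[of "0::real"]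
  proof eventually_elim
    case (elim t)
    then have pos: "measure P (A t) > 0" using exp_gt_zero less_le_trans by blast
    then have "(c - e) * v t \<le> ln (measure P (A t))"
      using elim by (metis exp_gt_zero ln_exp ln_le_cancel_iff)
    then show ?case using pos v[of t] elim by (simp add: log_prob_def field_simps)
  qed
  then have "ereal (c - e) \<le> Liminf at_top (\<lambda>t. ereal (1 / v t) * log_prob (measure P (A t)))"
    by (rule Liminf_bounded)
  then have "ereal (c - e) + ereal e
      \<le> Liminf at_top (\<lambda>t. ereal (1 / v t) * log_prob (measure P (A t))) + ereal e"
    by (rule add_right_mono)
  then show "ereal c \<le> Liminf at_top (\<lambda>t. ereal (1 / v t) * log_prob (measure P (A t))) + ereal e"
    by simp
qed

text \<open>The setting of the Gaertner-Ellis theorem with a limit \<open>L\<close> that is finite everywhere.\<close>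

locale exponential_family_limit = prob_space P
  for P :: "'w measure" +
  fixes Z :: "real \<Rightarrow> 'w \<Rightarrow> 'a::euclidean_space" and v :: "real \<Rightarrow> real" and L :: "'a \<Rightarrow> real"
  assumes Z [measurable]: "\<And>t. 0 < t \<Longrightarrow> Z t \<in> borel_measurable P"
    and v_pos: "\<And>t. 0 < t \<Longrightarrow> 0 < v t"
    and v_lim: "filterlim v at_top at_top"
    and int: "\<And>\<theta> t. 0 < t \<Longrightarrow> integrable P (\<lambda>\<omega>. exp (v t * (\<theta> \<bullet> Z t \<omega>)))"
    and L: "\<And>\<theta>. ((\<lambda>t. ln (expectation (\<lambda>\<omega>. exp (v t * (\<theta> \<bullet> Z t \<omega>)))) / v t) \<longlongrightarrow> L \<theta>) at_top"
begin

abbreviation mgf :: "'a \<Rightarrow> real \<Rightarrow> real"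
  where "mgf \<theta> t \<equiv> expectation (\<lambda>\<omega>. exp (v t * (\<theta> \<bullet> Z t \<omega>)))"

lemma mgf_pos: "0 < t \<Longrightarrow> 0 < mgf \<theta> t"
  by (intro expectation_greater int) auto

lemma L_zero: "L 0 = 0"
proof -
  have "((\<lambda>t::real. 0::real) \<longlongrightarrow> L 0) at_top" using L[of 0] by (simp add: prob_space)
  then show ?thesis by (metis tendsto_const tendsto_unique trivial_limit_at_top_linorder)
qed

lemma mgf_bounds:
  assumes "0 < e"
  shows "\<forall>\<^sub>F t in at_top. exp ((L \<theta> - e) * v t) \<le> mgf \<theta> t \<and> mgf \<theta> t \<le> exp ((L \<theta> + e) * v t)"
proof -
  have "\<forall>\<^sub>F t in at_top. dist (ln (mgf \<theta> t) / v t) (L \<theta>) < e"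
    using L[of \<theta>] assms by (rule tendstoD)
  then show ?thesis using eventually_gt_at_top[of "0::real"]
  proof eventually_elim
    case (elim t)
    then have "(L \<theta> - e) * v t \<le> ln (mgf \<theta> t)" "ln (mgf \<theta> t) \<le> (L \<theta> + e) * v t"
      using v_pos[of t] by (auto simp: dist_real_def abs_less_iff field_simps)
    then have "exp ((L \<theta> - e) * v t) \<le> exp (ln (mgf \<theta> t))" "exp (ln (mgf \<theta> t)) \<le> exp ((L \<theta> + e) * v t)"
      by simp_all
    then show ?case using mgf_pos[of t \<theta>] elim by simp
  qed
qed

text \<open>Markov's inequality for the measure with density proportional to \<open>exp (v t * (\<eta> \<bullet> Z t))\<close>; the
  case \<open>\<eta> = 0\<close> is the usual Chernoff bound. Keeping the density inside the expectation makes it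
  unnecessary to introduce the tilted measure.\<close>

lemma tilted_chernoff:
  assumes t: "0 < t"
  shows "expectation (\<lambda>\<omega>. exp (v t * (\<eta> \<bullet> Z t \<omega>)) * indicator {\<omega>. r \<le> \<theta> \<bullet> Z t \<omega>} \<omega>)
    \<le> exp (- (r * v t)) * mgf (\<eta> + \<theta>) t"
proof -
  have [measurable]: "Z t \<in> borel_measurable P" using t by (rule Z)
  have "expectation (\<lambda>\<omega>. exp (v t * (\<eta> \<bullet> Z t \<omega>)) * indicator {\<omega>. r \<le> \<theta> \<bullet> Z t \<omega>} \<omega>)
      \<le> expectation (\<lambda>\<omega>. exp (- (r * v t)) * exp (v t * ((\<eta> + \<theta>) \<bullet> Z t \<omega>)))"
  proof (rule integral_mono)
    show "integrable P (\<lambda>\<omega>. exp (v t * (\<eta> \<bullet> Z t \<omega>)) * indicator {\<omega>. r \<le> \<theta> \<bullet> Z t \<omega>} \<omega>)"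
      by (rule Bochner_Integration.integrable_bound[OF int[OF t, of \<eta>]]) (auto simp: indicator_def)
    show "integrable P (\<lambda>\<omega>. exp (- (r * v t)) * exp (v t * ((\<eta> + \<theta>) \<bullet> Z t \<omega>)))"
      using int[OF t, of "\<eta> + \<theta>"] by simp
    fix \<omega>
    show "exp (v t * (\<eta> \<bullet> Z t \<omega>)) * indicator {\<omega>. r \<le> \<theta> \<bullet> Z t \<omega>} \<omega>
        \<le> exp (- (r * v t)) * exp (v t * ((\<eta> + \<theta>) \<bullet> Z t \<omega>))"
    proof (cases "r \<le> \<theta> \<bullet> Z t \<omega>")
      case True
      then have "r * v t \<le> v t * (\<theta> \<bullet> Z t \<omega>)"
        using v_pos[OF t] by (simp add: mult.commute)
      then show ?thesis using True by (simp add: mult_exp_exp inner_add_left algebra_simps)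
    qed simp
  qed
  then show ?thesis by simp
qed

lemma half_space_decay:
  "decay_rate P (\<lambda>t. {\<omega>\<in>space P. r \<le> \<theta> \<bullet> Z t \<omega>}) v (r - L \<theta>)"
  unfolding decay_rate_def
proof (intro allI impI)
  fix c assume c: "c < r - L \<theta>"
  have "\<forall>\<^sub>F t in at_top. mgf \<theta> t \<le> exp ((L \<theta> + (r - L \<theta> - c)) * v t)"
    using mgf_bounds[of "r - L \<theta> - c" \<theta>] c by (auto elim: eventually_mono)
  then show "\<forall>\<^sub>F t in at_top. prob {\<omega>\<in>space P. r \<le> \<theta> \<bullet> Z t \<omega>} \<le> exp (- c * v t)"
    using eventually_gt_at_top[of "0::real"]
  proof eventually_elim
    case (elim t)
    have [measurable]: "Z t \<in> borel_measurable P" using elim by (intro Z)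
    have "prob {\<omega>\<in>space P. r \<le> \<theta> \<bullet> Z t \<omega>} = expectation (indicator {\<omega>\<in>space P. r \<le> \<theta> \<bullet> Z t \<omega>})"
      by simp
    also have "\<dots> = expectation (\<lambda>\<omega>. exp (v t * (0 \<bullet> Z t \<omega>)) * indicator {\<omega>. r \<le> \<theta> \<bullet> Z t \<omega>} \<omega>)"
      by (intro Bochner_Integration.integral_cong) (auto simp: indicator_def)
    also have "\<dots> \<le> exp (- (r * v t)) * mgf (0 + \<theta>) t" using elim by (intro tilted_chernoff)
    also have "\<dots> \<le> exp (- (r * v t)) * exp ((L \<theta> + (r - L \<theta> - c)) * v t)"
      using elim by (intro mult_left_mono) auto
    also have "\<dots> = exp (- c * v t)" by (simp add: mult_exp_exp algebra_simps)
    finally show ?case .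
  qed
qed

text \<open>Each point of \<open>F\<close> is separated by an open half-space on which Chernoff's bound already has rate
  \<open>c\<close>. Finitely many of them cover the part of \<open>F\<close> in a large cube, and the outside of the cube is
  covered by coordinate half-spaces that are just as unlikely.\<close>

lemma closed_set_decay:
  assumes F: "closed F" and c: "\<And>x. x \<in> F \<Longrightarrow> ereal c < legendre_transform L x"
  shows "decay_rate P (\<lambda>t. {\<omega>\<in>space P. Z t \<omega> \<in> F}) v c"
proof -
  define R where "R = (\<Sum>b\<in>Basis \<union> uminus ` Basis. \<bar>c + L b\<bar>)"
  define B where "B = (Basis \<union> uminus ` Basis :: 'a set)"
  have finB: "finite B" by (simp add: B_def)
  have R: "c \<le> R - L b" if "b \<in> B" for b
  proof -
    have "\<bar>c + L b\<bar> \<le> R" unfolding R_def using that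
      by (intro member_le_sum[where f = "\<lambda>b. \<bar>c + L b\<bar>"]) (auto simp: B_def)
    then show ?thesis by linarith
  qed
  define K where "K = F \<inter> {x. \<forall>b\<in>B. b \<bullet> x \<le> R}"
  have "compact K"
  proof -
    have "norm x \<le> real DIM('a) * R" if "x \<in> K" for x
    proof -
      have "\<bar>x \<bullet> b\<bar> \<le> R" if b: "b \<in> Basis" for b
      proof -
        have "b \<in> B" "- b \<in> B" using b by (auto simp: B_def)
        then have "b \<bullet> x \<le> R" "(- b) \<bullet> x \<le> R" using \<open>x \<in> K\<close> by (auto simp: K_def)
        then show ?thesis by (simp add: inner_commute abs_le_iff)
      qed
      then have "(\<Sum>b\<in>Basis. \<bar>x \<bullet> b\<bar>) \<le> real DIM('a) * R"
        by (intro sum_bounded_above) auto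
      then show ?thesis using norm_le_l1[of x] by linarith
    qed
    then have "bounded K" by (auto intro: boundedI)
    moreover have "closed {x. \<forall>b\<in>B. b \<bullet> x \<le> R}"
      unfolding Collect_ball_eq by (intro closed_INT ballI closed_Collect_le continuous_intros)
    ultimately show ?thesis unfolding K_def compact_eq_bounded_closed using F by auto
  qed
  have "\<exists>\<theta>. c < \<theta> \<bullet> x - L \<theta>" if "x \<in> K" for x
    using c[of x] that by (auto simp: K_def legendre_transform_def less_SUP_iff)
  then obtain T where T: "\<And>x. x \<in> K \<Longrightarrow> c < T x \<bullet> x - L (T x)" by metis
  define U where "U \<theta> = {x. c + L \<theta> < \<theta> \<bullet> x}" for \<theta>
  have "K \<subseteq> (\<Union>x\<in>K. U (T x))" using T by (force simp: U_def)
  moreover have "open (U \<theta>)" for \<theta>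
    unfolding U_def by (intro open_Collect_less continuous_intros)
  ultimately obtain D where D: "D \<subseteq> K" "finite D" "K \<subseteq> (\<Union>x\<in>D. U (T x))"
    using compactE_image[OF \<open>compact K\<close>, of K "\<lambda>x. U (T x)"] by metis
  define H where "H p t = {\<omega>\<in>space P. snd p \<le> fst p \<bullet> Z t \<omega>}" for p :: "'a \<times> real" and t
  define I where "I = (\<lambda>x. (T x, c + L (T x))) ` D \<union> (\<lambda>b. (b, R)) ` B"
  have Hm: "H p t \<in> sets P" if "0 < t" for p t
  proof -
    have [measurable]: "Z t \<in> borel_measurable P" using that by (rule Z)
    show ?thesis unfolding H_def by measurable
  qed
  have "decay_rate P (\<lambda>t. \<Union>p\<in>I. H p t) v c"
  proof (rule decay_rate_finite_UN)
    show "prob_space P" by unfold_locales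
    show "finite I" using D finB by (auto simp: I_def)
    fix p assume p: "p \<in> I"
    then have "c \<le> snd p - L (fst p)" using R by (auto simp: I_def)
    then show "decay_rate P (H p) v c"
      using half_space_decay[of "snd p" "fst p"] unfolding H_def decay_rate_def by auto
    show "\<forall>\<^sub>F t in at_top. H p t \<in> sets P"
      using eventually_gt_at_top[of "0::real"] by eventually_elim (rule Hm)
  qed (rule v_lim)
  moreover have "{\<omega>\<in>space P. Z t \<omega> \<in> F} \<subseteq> (\<Union>p\<in>I. H p t)" for t
  proof
    fix \<omega> assume \<omega>: "\<omega> \<in> {\<omega>\<in>space P. Z t \<omega> \<in> F}"
    show "\<omega> \<in> (\<Union>p\<in>I. H p t)"
    proof (cases "Z t \<omega> \<in> K")
      case True
      then obtain x where "x \<in> D" "Z t \<omega> \<in> U (T x)" using D by auto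
      then show ?thesis using \<omega> by (force simp: I_def H_def U_def)
    next
      case False
      then obtain b where "b \<in> B" "R < b \<bullet> Z t \<omega>" using \<omega> by (auto simp: K_def not_le)
      then show ?thesis using \<omega> by (force simp: I_def H_def)
    qed
  qed
  moreover have "(\<Union>p\<in>I. H p t) \<in> sets P" if "0 < t" for t
    using Hm[OF that] D(2) finB by (auto simp: I_def intro!: sets.finite_UN)
  ultimately show ?thesis by (rule decay_rate_mono[OF prob_space_axioms])
qed

text \<open>Under the tilt by \<open>\<eta>\<close> the limiting logarithmic moment generating function is
  \<open>\<theta> \<mapsto> L (\<eta> + \<theta>) - L \<eta>\<close>, whose gradient at \<open>0\<close> is \<open>x\<close>. Hence in direction \<open>b\<close> a small multiple
  \<open>s\<close> already makes the Chernoff exponent of \<open>b \<bullet> Z t \<ge> b \<bullet> x + r\<close> strictly positive.\<close>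

lemma tilted_half_space_negligible:
  assumes D: "(L has_derivative (\<lambda>h. h \<bullet> x)) (at \<eta>)" and r: "0 < r" and q: "0 < q"
  shows "\<forall>\<^sub>F t in at_top. expectation (\<lambda>\<omega>. exp (v t * (\<eta> \<bullet> Z t \<omega>)) * indicator {\<omega>. b \<bullet> x + r \<le> b \<bullet> Z t \<omega>} \<omega>)
    \<le> q * mgf \<eta> t"
proof -
  have D0: "(L has_derivative (\<lambda>h. h \<bullet> x)) (at (\<eta> + 0 *\<^sub>R b))" using D by simp
  have "((\<lambda>s. L (\<eta> + s *\<^sub>R b)) has_derivative (\<lambda>h. (h *\<^sub>R b) \<bullet> x)) (at 0)"
    by (rule has_derivative_compose[where g = L and f = "\<lambda>s. \<eta> + s *\<^sub>R b", OF _ D0]) (auto intro!: derivative_eq_intros)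
  then have "((\<lambda>s. L (\<eta> + s *\<^sub>R b)) has_real_derivative (b \<bullet> x)) (at 0)"
    by (simp add: has_field_derivative_def mult_commute_abs)
  then have "((\<lambda>s. (L (\<eta> + s *\<^sub>R b) - L \<eta>) / s) \<longlongrightarrow> b \<bullet> x) (at 0)"
    by (simp add: DERIV_def)
  then have "((\<lambda>s. (L (\<eta> + s *\<^sub>R b) - L \<eta>) / s) \<longlongrightarrow> b \<bullet> x) (at_right 0)"
    by (rule tendsto_mono[rotated]) (simp add: at_le)
  then have "\<forall>\<^sub>F s in at_right 0. (L (\<eta> + s *\<^sub>R b) - L \<eta>) / s < b \<bullet> x + r"
    by (rule order_tendstoD) (use r in simp)
  then have "\<forall>\<^sub>F s in at_right (0::real). 0 < s \<and> (L (\<eta> + s *\<^sub>R b) - L \<eta>) / s < b \<bullet> x + r"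
    using eventually_at_right_less[of "0::real"] by eventually_elim simp
  then obtain s where s: "0 < s" "(L (\<eta> + s *\<^sub>R b) - L \<eta>) / s < b \<bullet> x + r"
    by (metis (no_types, lifting) eventually_happens' trivial_limit_at_right_real)
  \<comment> \<open>the rate at which the tilted mass of the half-space decays; a third of it is spent on each of
    the two approximations of \<open>mgf\<close> by \<open>L\<close>\<close>
  define \<kappa> where "\<kappa> = s * (b \<bullet> x + r) - (L (\<eta> + s *\<^sub>R b) - L \<eta>)"
  have \<kappa>: "\<kappa> > 0" using s by (simp add: \<kappa>_def field_simps)
  have "\<forall>\<^sub>F t in at_top. - ln q / (\<kappa> / 3) \<le> v t" using v_lim by (simp add: filterlim_at_top)
  moreover have "\<forall>\<^sub>F t in at_top. mgf (\<eta> + s *\<^sub>R b) t \<le> exp ((L (\<eta> + s *\<^sub>R b) + \<kappa> / 3) * v t)"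
    using mgf_bounds[of "\<kappa> / 3" "\<eta> + s *\<^sub>R b"] \<kappa> by (auto elim: eventually_mono)
  moreover have "\<forall>\<^sub>F t in at_top. exp ((L \<eta> - \<kappa> / 3) * v t) \<le> mgf \<eta> t"
    using mgf_bounds[of "\<kappa> / 3" \<eta>] \<kappa> by (auto elim: eventually_mono)
  ultimately show ?thesis using eventually_gt_at_top[of "0::real"]
  proof eventually_elim
    case (elim t)
    have set_eq: "{\<omega>. b \<bullet> x + r \<le> b \<bullet> Z t \<omega>} = {\<omega>. s * (b \<bullet> x + r) \<le> (s *\<^sub>R b) \<bullet> Z t \<omega>}"
      using s by simp
    have "expectation (\<lambda>\<omega>. exp (v t * (\<eta> \<bullet> Z t \<omega>)) * indicator {\<omega>. b \<bullet> x + r \<le> b \<bullet> Z t \<omega>} \<omega>)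
        \<le> exp (- ((s * (b \<bullet> x + r)) * v t)) * mgf (\<eta> + s *\<^sub>R b) t"
      unfolding set_eq by (rule tilted_chernoff) (use elim in simp)
    also have "\<dots> \<le> exp (- ((s * (b \<bullet> x + r)) * v t)) * exp ((L (\<eta> + s *\<^sub>R b) + \<kappa> / 3) * v t)"
      using elim by (intro mult_left_mono) auto
    also have "\<dots> = exp (- (\<kappa> / 3 * v t)) * exp ((L \<eta> - \<kappa> / 3) * v t)"
    proof -
      have "s * (b \<bullet> x + r) = \<kappa> + (L (\<eta> + s *\<^sub>R b) - L \<eta>)" by (simp add: \<kappa>_def)
      then show ?thesis unfolding mult_exp_exp by (simp only:) (simp add: field_simps)
    qed
    also have "\<dots> \<le> q * mgf \<eta> t"
    proof (intro mult_mono)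
      have "- ln q \<le> v t * (\<kappa> / 3)"
        using elim(1) \<kappa> by (subst (asm) pos_divide_le_eq) auto
      then have "exp (- (\<kappa> / 3 * v t)) \<le> exp (ln q)" by (simp add: mult.commute)
      then show "exp (- (\<kappa> / 3 * v t)) \<le> q" using q by simp
    qed (use elim q in auto)
    finally show ?case .
  qed
qed

text \<open>The tilted mass concentrates on a small cube around \<open>x\<close> inside \<open>G\<close>. There the tilting density is at
  most \<open>exp (v t * (\<eta> \<bullet> x + e / 3))\<close>, so the original probability of \<open>G\<close> is at least half of
  \<open>mgf \<eta> t\<close> divided by this bound.\<close>

lemma open_set_lower_bound:
  assumes G: "open G" "x \<in> G" and D: "(L has_derivative (\<lambda>h. h \<bullet> x)) (at \<eta>)" and e: "0 < e"
  shows "\<forall>\<^sub>F t in at_top. exp ((L \<eta> - \<eta> \<bullet> x - e) * v t) \<le> prob {\<omega>\<in>space P. Z t \<omega> \<in> G}"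
proof -
  define B where "B = (Basis \<union> uminus ` Basis :: 'a set)"
  have B: "finite B" "B \<noteq> {}" by (auto simp: B_def)
  define N where "N = real (card B)"
  have N: "N > 0" using B by (simp add: N_def card_gt_0_iff)
  have "open (G \<inter> {z. \<eta> \<bullet> z < \<eta> \<bullet> x + e / 3})"
    by (intro open_Int G open_Collect_less continuous_intros)
  moreover have "x \<in> G \<inter> {z. \<eta> \<bullet> z < \<eta> \<bullet> x + e / 3}" using G e by simp
  ultimately obtain \<delta> where \<delta>: "0 < \<delta>" "ball x \<delta> \<subseteq> G \<inter> {z. \<eta> \<bullet> z < \<eta> \<bullet> x + e / 3}"
    by (metis open_contains_ball)
  \<comment> \<open>half the side of a cube contained in the ball of radius \<open>\<delta>\<close>, by comparison with the
    \<open>l\<^sup>1\<close>-norm\<close>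
  define r where "r = \<delta> / (2 * real DIM('a))"
  have r: "r > 0" using \<delta> by (simp add: r_def)
  have near: "z \<in> G \<and> \<eta> \<bullet> z < \<eta> \<bullet> x + e / 3" if z: "\<And>b. b \<in> B \<Longrightarrow> b \<bullet> z < b \<bullet> x + r" for z
  proof -
    have "\<bar>(z - x) \<bullet> b\<bar> \<le> r" if b: "b \<in> Basis" for b
    proof -
      have "b \<in> B" "- b \<in> B" using b by (auto simp: B_def)
      then have "b \<bullet> z < b \<bullet> x + r" "(- b) \<bullet> z < (- b) \<bullet> x + r" using z by blast+
      then show ?thesis
        by (simp add: inner_commute[of "z - x"] inner_diff_right abs_le_iff)
    qed
    then have "(\<Sum>b\<in>Basis. \<bar>(z - x) \<bullet> b\<bar>) \<le> real DIM('a) * r"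
      by (intro sum_bounded_above) auto
    then have "norm (z - x) \<le> \<delta> / 2" using norm_le_l1[of "z - x"] by (simp add: r_def)
    then have "z \<in> ball x \<delta>" using \<delta>(1) by (simp add: dist_norm norm_minus_commute)
    then show ?thesis using \<delta>(2) by blast
  qed
  define T where "T b t = expectation (\<lambda>\<omega>. exp (v t * (\<eta> \<bullet> Z t \<omega>)) * indicator {\<omega>. b \<bullet> x + r \<le> b \<bullet> Z t \<omega>} \<omega>)" for b t
  \<comment> \<open>with this constant the half-spaces together carry at most half of the tilted mass\<close>
  have "\<forall>\<^sub>F t in at_top. \<forall>b\<in>B. T b t \<le> 1 / (2 * N) * mgf \<eta> t"
    unfolding T_def using N r B D
    by (intro eventually_ball_finite ballI tilted_half_space_negligible) auto
  moreover have "\<forall>\<^sub>F t in at_top. exp ((L \<eta> - e / 3) * v t) \<le> mgf \<eta> t"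
    using mgf_bounds[of "e / 3" \<eta>] e by (auto elim: eventually_mono)
  moreover have "\<forall>\<^sub>F t in at_top. ln 2 / (e / 3) \<le> v t" using v_lim by (simp add: filterlim_at_top)
  ultimately show ?thesis using eventually_gt_at_top[of "0::real"]
  proof eventually_elim
    case (elim t)
    note [measurable] = Z[OF \<open>0 < t\<close>] borel_open[OF G(1)]
    define p where "p = prob {\<omega>\<in>space P. Z t \<omega> \<in> G}"
    define X where "X = exp (- (v t * (\<eta> \<bullet> x + e / 3)) + (L \<eta> - e / 3) * v t)"
    define w where "w \<omega> = exp (v t * (\<eta> \<bullet> Z t \<omega>))" for \<omega>
    have [measurable]: "w \<in> borel_measurable P" unfolding w_def by measurable
    have iw: "integrable P w" unfolding w_def using int elim by simp
    have iT: "integrable P (\<lambda>\<omega>. w \<omega> * indicator {\<omega>. b \<bullet> x + r \<le> b \<bullet> Z t \<omega>} \<omega>)" for b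
      by (rule Bochner_Integration.integrable_bound[OF iw]) (auto simp: indicator_def)
    have iG: "integrable P (\<lambda>\<omega>. exp (v t * (\<eta> \<bullet> x + e / 3)) * indicator {\<omega>\<in>space P. Z t \<omega> \<in> G} \<omega>)"
      by (intro integrable_mult_right integrable_real_indicator) (auto simp: emeasure_eq_measure)
    have "mgf \<eta> t = expectation w" by (simp add: w_def[abs_def])
    also have "\<dots> \<le> expectation (\<lambda>\<omega>. exp (v t * (\<eta> \<bullet> x + e / 3)) * indicator {\<omega>\<in>space P. Z t \<omega> \<in> G} \<omega>
        + (\<Sum>b\<in>B. w \<omega> * indicator {\<omega>. b \<bullet> x + r \<le> b \<bullet> Z t \<omega>} \<omega>))"
    proof (rule integral_mono[OF iw])
      show "integrable P (\<lambda>\<omega>. exp (v t * (\<eta> \<bullet> x + e / 3)) * indicator {\<omega>\<in>space P. Z t \<omega> \<in> G} \<omega>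
        + (\<Sum>b\<in>B. w \<omega> * indicator {\<omega>. b \<bullet> x + r \<le> b \<bullet> Z t \<omega>} \<omega>))"
        using iT iG by auto
      fix \<omega> assume \<omega>: "\<omega> \<in> space P"
      have w0: "w \<omega> > 0" by (simp add: w_def)
      have sum0: "0 \<le> (\<Sum>b\<in>B. w \<omega> * indicator {\<omega>. b \<bullet> x + r \<le> b \<bullet> Z t \<omega>} \<omega>)"
        using w0 by (intro sum_nonneg) auto
      show "w \<omega> \<le> exp (v t * (\<eta> \<bullet> x + e / 3)) * indicator {\<omega>\<in>space P. Z t \<omega> \<in> G} \<omega>
        + (\<Sum>b\<in>B. w \<omega> * indicator {\<omega>. b \<bullet> x + r \<le> b \<bullet> Z t \<omega>} \<omega>)"
      proof (cases "\<exists>b\<in>B. b \<bullet> x + r \<le> b \<bullet> Z t \<omega>")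
        case True
        then obtain b where b: "b \<in> B" "b \<bullet> x + r \<le> b \<bullet> Z t \<omega>" by blast
        then have "w \<omega> = w \<omega> * indicator {\<omega>. b \<bullet> x + r \<le> b \<bullet> Z t \<omega>} \<omega>" by simp
        also have "\<dots> \<le> (\<Sum>b\<in>B. w \<omega> * indicator {\<omega>. b \<bullet> x + r \<le> b \<bullet> Z t \<omega>} \<omega>)"
          using b w0 B by (intro member_le_sum[where f = "\<lambda>b. w \<omega> * indicator {\<omega>. b \<bullet> x + r \<le> b \<bullet> Z t \<omega>} \<omega>"]) auto
        finally show ?thesis by (simp add: add_increasing)
      next
        case False
        then have "Z t \<omega> \<in> G" "\<eta> \<bullet> Z t \<omega> < \<eta> \<bullet> x + e / 3" using near[of "Z t \<omega>"] by (auto simp: not_le)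
        then have "w \<omega> \<le> exp (v t * (\<eta> \<bullet> x + e / 3)) * indicator {\<omega>\<in>space P. Z t \<omega> \<in> G} \<omega>"
          using \<omega> v_pos elim by (simp add: w_def)
        then show ?thesis using sum0 by linarith
      qed
    qed
    also have "\<dots> = exp (v t * (\<eta> \<bullet> x + e / 3)) * p + (\<Sum>b\<in>B. T b t)"
      using iG iT by (simp add: p_def T_def w_def)
    also have "(\<Sum>b\<in>B. T b t) \<le> N * (1 / (2 * N) * mgf \<eta> t)"
      unfolding N_def using elim by (intro sum_bounded_above) (auto simp: N_def)
    also have "N * (1 / (2 * N) * mgf \<eta> t) = mgf \<eta> t / 2" using N by simp
    finally have "mgf \<eta> t / 2 \<le> exp (v t * (\<eta> \<bullet> x + e / 3)) * p" by simp
    then have "exp ((L \<eta> - e / 3) * v t) / 2 \<le> exp (v t * (\<eta> \<bullet> x + e / 3)) * p"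
      using elim by linarith
    then have "exp (- (v t * (\<eta> \<bullet> x + e / 3))) * (exp ((L \<eta> - e / 3) * v t) / 2)
        \<le> exp (- (v t * (\<eta> \<bullet> x + e / 3))) * (exp (v t * (\<eta> \<bullet> x + e / 3)) * p)"
      by (intro mult_left_mono) auto
    also have "\<dots> = p" by (simp add: mult.assoc[symmetric] mult_exp_exp)
    finally have half: "X * (1 / 2) \<le> p"
      unfolding X_def mult_exp_exp[symmetric] by (simp only: times_divide_eq_right mult_1_right)
    have "ln 2 \<le> v t * (e / 3)"
      using elim(3) e by (subst (asm) pos_divide_le_eq) auto
    then have "exp (- (v t * (e / 3))) \<le> exp (- ln 2)" by simp
    also have "\<dots> = 1 / 2" by (simp add: exp_minus)
    finally have small: "exp (- (v t * (e / 3))) \<le> 1 / 2" .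
    have "exp ((L \<eta> - \<eta> \<bullet> x - e) * v t) = X * exp (- (v t * (e / 3)))"
      unfolding X_def mult_exp_exp by (rule arg_cong[where f = exp]) (simp add: field_simps)
    also have "\<dots> \<le> X * (1 / 2)" using small by (intro mult_left_mono) (auto simp: X_def)
    also have "\<dots> \<le> p" by (rule half)
    finally show ?case unfolding p_def .
  qed
qed

text \<open>If \<open>x\<close> is the gradient of \<open>L\<close> at \<open>\<eta>\<close>, the lower bound obtained at \<open>x\<close> is \<open>L \<eta> - \<eta> \<bullet> x\<close>, and
  \<open>\<eta> \<bullet> x - L \<eta>\<close> is one of the terms in the supremum that defines the Legendre transform. So the
  lower bound has the right rate without identifying the maximiser.\<close>

theorem gaertner_ellis:
  assumes exposed: "\<And>x. \<exists>\<eta>. (L has_derivative (\<lambda>h. h \<bullet> x)) (at \<eta>)"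
  shows "satisfies_LDP P Z v (legendre_transform L)"
    and "good_rate_function (legendre_transform L)"
proof -
  show good: "good_rate_function (legendre_transform L)"
    by (rule legendre_transform_good_rate_function[of L, OF L_zero])
  have upper: "Limsup at_top (\<lambda>t. ereal (1 / v t) * log_prob (prob {\<omega>\<in>space P. Z t \<omega> \<in> F}))
      \<le> - (INF z\<in>F. legendre_transform L z)" if "closed F" for F
  proof (rule ccontr)
    let ?u = "Limsup at_top (\<lambda>t. ereal (1 / v t) * log_prob (prob {\<omega>\<in>space P. Z t \<omega> \<in> F}))"
    assume "\<not> ?u \<le> - (INF z\<in>F. legendre_transform L z)"
    then have "- (INF z\<in>F. legendre_transform L z) < ?u" by (simp only: not_le)
    from ereal_dense2[OF this] obtain c
      where c: "- (INF z\<in>F. legendre_transform L z) < ereal c" "ereal c < ?u" by blast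
    from c(1) have "ereal (- c) < (INF z\<in>F. legendre_transform L z)"
      using ereal_uminus_less_reorder[of "INF z\<in>F. legendre_transform L z" "ereal c"] by simp
    then have "decay_rate P (\<lambda>t. {\<omega>\<in>space P. Z t \<omega> \<in> F}) v (- c)"
      by (intro closed_set_decay[OF that]) (rule less_le_trans[OF _ INF_lower])
    then have "?u \<le> ereal (- (- c))"
      by (rule Limsup_log_prob_le) (rule v_pos)
    then show False using c(2) by simp
  qed
  have lower: "- (INF z\<in>G. legendre_transform L z)
      \<le> Liminf at_top (\<lambda>t. ereal (1 / v t) * log_prob (prob {\<omega>\<in>space P. Z t \<omega> \<in> G}))" if "open G" for G
  proof -
    have "- Liminf at_top (\<lambda>t. ereal (1 / v t) * log_prob (prob {\<omega>\<in>space P. Z t \<omega> \<in> G}))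
        \<le> legendre_transform L x" if "x \<in> G" for x
    proof -
      from exposed[of x] obtain \<eta> where \<eta>: "(L has_derivative (\<lambda>h. h \<bullet> x)) (at \<eta>)" ..
      have "ereal (L \<eta> - \<eta> \<bullet> x) \<le> Liminf at_top (\<lambda>t. ereal (1 / v t) * log_prob (prob {\<omega>\<in>space P. Z t \<omega> \<in> G}))"
        using open_set_lower_bound[OF \<open>open G\<close> that \<eta>] v_pos by (rule Liminf_log_prob_ge)
      then have "- Liminf at_top (\<lambda>t. ereal (1 / v t) * log_prob (prob {\<omega>\<in>space P. Z t \<omega> \<in> G}))
          \<le> ereal (\<eta> \<bullet> x - L \<eta>)"
        unfolding ereal_uminus_le_reorder[of "Liminf at_top _"] by simp
      also have "\<dots> \<le> legendre_transform L x" by (rule legendre_transform_ge)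
      finally show ?thesis .
    qed
    then have "- Liminf at_top (\<lambda>t. ereal (1 / v t) * log_prob (prob {\<omega>\<in>space P. Z t \<omega> \<in> G}))
        \<le> (INF z\<in>G. legendre_transform L z)" by (rule INF_greatest)
    then show ?thesis by (subst ereal_uminus_le_reorder)
  qed
  have "rate_function (legendre_transform L)" using good by (simp add: good_rate_function_def)
  then show "satisfies_LDP P Z v (legendre_transform L)"
    unfolding satisfies_LDP_def
    by (intro conjI allI impI prob_space_axioms Z v_lim upper lower)
qed

end

section \<open>Moderate scaling\<close>

lemma second_order_difference_quotient:
  fixes f f' :: "real \<Rightarrow> real"
  assumes f: "\<And>x. (f has_real_derivative f' x) (at x)"
    and f': "(f' has_real_derivative c) (at 0)"
  shows "((\<lambda>x. (f x - f 0 - x * f' 0) / x\<^sup>2) \<longlongrightarrow> c / 2) (at 0)"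
proof (rule lhopital[where f' = "\<lambda>x. f' x - f' 0" and g' = "\<lambda>x. 2 * x"])
  have "isCont f 0" using f DERIV_isCont by blast
  then have "(f \<longlongrightarrow> f 0) (at 0)" by (simp add: isCont_def)
  then have "((\<lambda>x. f x - f 0 - x * f' 0) \<longlongrightarrow> f 0 - f 0 - 0 * f' 0) (at 0)"
    by (intro tendsto_intros)
  then show "((\<lambda>x. f x - f 0 - x * f' 0) \<longlongrightarrow> 0) (at 0)" by simp
  have "((\<lambda>x::real. x\<^sup>2) \<longlongrightarrow> 0\<^sup>2) (at 0)" by (intro tendsto_intros)
  then show "((\<lambda>x::real. x\<^sup>2) \<longlongrightarrow> 0) (at 0)" by simp
  show "\<forall>\<^sub>F x in at 0. (x::real)\<^sup>2 \<noteq> 0" "\<forall>\<^sub>F x in at 0. 2 * (x::real) \<noteq> 0"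
    by (auto simp: eventually_at_filter)
  show "\<forall>\<^sub>F x in at 0. ((\<lambda>x. f x - f 0 - x * f' 0) has_real_derivative f' x - f' 0) (at x)"
    by (intro always_eventually allI) (auto intro!: derivative_eq_intros f)
  show "\<forall>\<^sub>F x in at 0. ((\<lambda>x. x\<^sup>2) has_real_derivative 2 * x) (at (x::real))"
    by (intro always_eventually allI) (auto intro!: derivative_eq_intros)
  have "((\<lambda>x. (f' x - f' 0) / x * (1 / 2)) \<longlongrightarrow> c * (1 / 2)) (at 0)"
    using f' by (intro tendsto_intros) (simp add: has_field_derivative_iff)
  then show "((\<lambda>x. (f' x - f' 0) / (2 * x)) \<longlongrightarrow> c / 2) (at 0)"
    by (simp add: mult.commute)
qed

text \<open>The expression splits into \<open>a t\<close> times the bounded error, the Taylor quotient at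
  \<open>\<epsilon> = 1 / sqrt (t * a t)\<close>, and \<open>a t * \<epsilon> * (t * d - m t)\<close>. For the last one, \<open>jensen\<close> at
  \<open>\<plusminus> \<delta>\<close> with \<open>\<delta> = 1 / sqrt t\<close> bounds \<open>\<delta> * (t * d - m t)\<close> by a constant, and
  \<open>a t * \<epsilon> = sqrt (a t) * \<delta>\<close>. The approximation is assumed along every null function because it
  is needed both at \<open>\<epsilon>\<close> and at \<open>\<plusminus> \<delta>\<close>.\<close>

lemma moderate_scaling_of_log_mgf:
  fixes l :: "real \<Rightarrow> real \<Rightarrow> real" and m \<psi> a :: "real \<Rightarrow> real"
  assumes jensen: "\<And>t \<epsilon>. 0 < t \<Longrightarrow> \<epsilon> * m t \<le> l t \<epsilon>"
    and approx: "\<And>f. (f \<longlongrightarrow> 0) at_top \<Longrightarrow> \<forall>\<^sub>F t in at_top. \<bar>l t (f t) - t * (\<psi> (f t) - \<psi> 0)\<bar> \<le> K"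
    and taylor: "((\<lambda>x. (\<psi> x - \<psi> 0 - x * d) / x\<^sup>2) \<longlongrightarrow> c) (at 0)"
    and a_pos: "\<And>t. 0 < t \<Longrightarrow> 0 < a t" and a_lim: "(a \<longlongrightarrow> 0) at_top"
    and ta_lim: "filterlim (\<lambda>t. t * a t) at_top at_top"
  shows "((\<lambda>t. a t * (l t (1 / sqrt (t * a t)) - 1 / sqrt (t * a t) * m t)) \<longlongrightarrow> c) at_top"
proof -
  define \<epsilon> where "\<epsilon> t = 1 / sqrt (t * a t)" for t
  define \<delta> where "\<delta> t = 1 / sqrt t" for t :: real
  have inv_sqrt: "((\<lambda>t. 1 / sqrt (g t)) \<longlongrightarrow> 0) at_top"
    if "filterlim g at_top at_top" for g :: "real \<Rightarrow> real"
    using tendsto_inverse_0_at_top[OF filterlim_compose[OF sqrt_at_top that]]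
    by (simp add: inverse_eq_divide)
  have \<epsilon>0: "(\<epsilon> \<longlongrightarrow> 0) at_top" unfolding \<epsilon>_def by (rule inv_sqrt[OF ta_lim])
  have \<delta>0: "(\<delta> \<longlongrightarrow> 0) at_top" unfolding \<delta>_def by (rule inv_sqrt[OF filterlim_ident])
  have m\<delta>0: "((\<lambda>t. - \<delta> t) \<longlongrightarrow> 0) at_top" using tendsto_minus[OF \<delta>0] by simp
  have taylor_along: "((\<lambda>t. (\<psi> (f t) - \<psi> 0 - f t * d) / (f t)\<^sup>2) \<longlongrightarrow> c) at_top"
    if "(f \<longlongrightarrow> 0) at_top" "\<forall>\<^sub>F t in at_top. f t \<noteq> 0" for f
    by (rule filterlim_compose[OF taylor]) (use that in \<open>simp add: filterlim_at\<close>)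
  have \<epsilon>_ne: "\<forall>\<^sub>F t in at_top. \<epsilon> t \<noteq> 0"
    using eventually_gt_at_top[of "0::real"]
    by eventually_elim (use a_pos in \<open>force simp: \<epsilon>_def\<close>)
  have \<delta>_ne: "\<forall>\<^sub>F t in at_top. \<delta> t \<noteq> 0"
    using eventually_gt_at_top[of "0::real"] by eventually_elim (simp add: \<delta>_def)
  define K' where "K' = K + \<bar>c\<bar> + 1"
  \<comment> \<open>\<open>f\<close> stands for \<open>\<delta>\<close> and \<open>- \<delta>\<close>\<close>
  have along: "\<forall>\<^sub>F t in at_top. f t * (m t - t * d) \<le> K'"
    if f: "(f \<longlongrightarrow> 0) at_top" "\<forall>\<^sub>F t in at_top. f t \<noteq> 0" and f2: "\<And>t. 0 < t \<Longrightarrow> t * (f t)\<^sup>2 = 1" for f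
  proof -
    have "\<forall>\<^sub>F t in at_top. (\<psi> (f t) - \<psi> 0 - f t * d) / (f t)\<^sup>2 < \<bar>c\<bar> + 1"
      by (rule order_tendstoD[OF taylor_along[OF f]]) linarith
    then show ?thesis using approx[OF f(1)] f(2) eventually_gt_at_top[of "0::real"]
    proof eventually_elim
      case (elim t)
      have "t * (\<psi> (f t) - \<psi> 0 - f t * d) = (t * (f t)\<^sup>2) * ((\<psi> (f t) - \<psi> 0 - f t * d) / (f t)\<^sup>2)"
        using elim by simp
      then have "t * (\<psi> (f t) - \<psi> 0 - f t * d) \<le> \<bar>c\<bar> + 1" using elim f2[of t] by simp
      then have "f t * m t \<le> K + (\<bar>c\<bar> + 1 + t * (f t * d))"
        using elim jensen[of t "f t"] by (simp add: algebra_simps abs_le_iff)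
      then show ?case by (simp add: K'_def algebra_simps)
    qed
  qed
  have "\<forall>\<^sub>F t in at_top. \<delta> t * (m t - t * d) \<le> K'"
    by (rule along[OF \<delta>0 \<delta>_ne]) (simp add: \<delta>_def power_divide)
  moreover have "\<forall>\<^sub>F t in at_top. - \<delta> t * (m t - t * d) \<le> K'"
    by (rule along[OF m\<delta>0]) (use \<delta>_ne in \<open>auto simp: \<delta>_def power_divide\<close>)
  ultimately have mean: "\<forall>\<^sub>F t in at_top. norm (a t * \<epsilon> t * (t * d - m t)) \<le> sqrt (a t) * K'"
    using eventually_gt_at_top[of "0::real"]
  proof eventually_elim
    case (elim t)
    have at: "0 < a t" using a_pos elim by simp
    have "\<bar>\<delta> t * (t * d - m t)\<bar> \<le> K'" using elim by (simp add: algebra_simps abs_le_iff)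
    moreover have "a t * \<epsilon> t = sqrt (a t) * \<delta> t"
      using at elim real_sqrt_mult_self[of "a t"]
      by (simp add: \<epsilon>_def \<delta>_def real_sqrt_mult field_simps)
    ultimately show ?case using at by (simp add: abs_mult mult.assoc mult_left_mono)
  qed
  have "((\<lambda>t. sqrt (a t) * K') \<longlongrightarrow> sqrt 0 * K') at_top" by (intro tendsto_intros a_lim)
  then have lim3: "((\<lambda>t. a t * \<epsilon> t * (t * d - m t)) \<longlongrightarrow> 0) at_top"
    by (intro Lim_null_comparison[OF mean]) simp
  have remainder: "\<forall>\<^sub>F t in at_top. norm (a t * (l t (\<epsilon> t) - t * (\<psi> (\<epsilon> t) - \<psi> 0))) \<le> a t * K"
    using approx[OF \<epsilon>0] eventually_gt_at_top[of "0::real"]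
    by eventually_elim (use a_pos in \<open>simp add: abs_mult mult_left_mono less_imp_le\<close>)
  have "((\<lambda>t. a t * K) \<longlongrightarrow> 0 * K) at_top" by (intro tendsto_intros a_lim)
  then have lim1: "((\<lambda>t. a t * (l t (\<epsilon> t) - t * (\<psi> (\<epsilon> t) - \<psi> 0))) \<longlongrightarrow> 0) at_top"
    by (intro Lim_null_comparison[OF remainder]) simp
  have "((\<lambda>t. a t * (l t (\<epsilon> t) - t * (\<psi> (\<epsilon> t) - \<psi> 0))
      + (\<psi> (\<epsilon> t) - \<psi> 0 - \<epsilon> t * d) / (\<epsilon> t)\<^sup>2 + a t * \<epsilon> t * (t * d - m t)) \<longlongrightarrow> 0 + c + 0) at_top"
    by (intro tendsto_add lim1 lim3 taylor_along[OF \<epsilon>0 \<epsilon>_ne])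
  moreover have "\<forall>\<^sub>F t in at_top. a t * (l t (\<epsilon> t) - t * (\<psi> (\<epsilon> t) - \<psi> 0))
      + (\<psi> (\<epsilon> t) - \<psi> 0 - \<epsilon> t * d) / (\<epsilon> t)\<^sup>2 + a t * \<epsilon> t * (t * d - m t)
      = a t * (l t (\<epsilon> t) - \<epsilon> t * m t)"
    using eventually_gt_at_top[of "0::real"]
  proof eventually_elim
    case (elim t)
    have "x / (\<epsilon> t)\<^sup>2 = a t * t * x" for x
      using elim a_pos[of t] by (simp add: \<epsilon>_def power_divide)
    then show ?case by (simp add: algebra_simps)
  qed
  ultimately have "((\<lambda>t. a t * (l t (\<epsilon> t) - \<epsilon> t * m t)) \<longlongrightarrow> 0 + c + 0) at_top"
    by (rule Lim_transform_eventually)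
  then show ?thesis by (simp add: \<epsilon>_def)
qed



section \<open>Growth of the Mittag-Leffler function\<close>

text \<open>Wendel's inequality: log-convexity of \<open>Gamma\<close> between \<open>y\<close> and \<open>y + 1\<close>.\<close>

lemma Gamma_shift_le_powr:
  fixes y s :: real
  assumes y: "0 < y" and s: "0 \<le> s" "s \<le> 1"
  shows "Gamma (y + s) \<le> Gamma y * y powr s"
proof -
  have "ln (Gamma ((1 - s) * y + s * (y + 1))) \<le> (1 - s) * ln (Gamma y) + s * ln (Gamma (y + 1))"
    using convex_onD[OF log_convex_Gamma_real, of s y "y + 1"] y s by simp
  moreover have "(1 - s) * y + s * (y + 1) = y + s" by (simp add: algebra_simps)
  moreover have "Gamma (y + 1) = y * Gamma y"
    using Gamma_plus1[of y] y by (auto simp: nonpos_Ints_def)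
  ultimately have "ln (Gamma (y + s)) \<le> ln (Gamma y) + s * ln y"
    using y Gamma_real_pos[OF y] less_imp_neq[OF Gamma_real_pos[OF y]]
    by (simp add: ln_mult algebra_simps)
  also have "\<dots> = ln (Gamma y * y powr s)"
    using y Gamma_real_pos[OF y] less_imp_neq[OF Gamma_real_pos[OF y]]
    by (simp add: ln_mult ln_powr)
  finally show ?thesis
    using y s Gamma_real_pos[of "y + s"] Gamma_real_pos[OF y] by simp
qed

text \<open>A lower bound for \<open>Gamma\<close> from the upper one: apply \<open>Gamma_shift_le_powr\<close> at \<open>n + 1 + s\<close> with the complementary shift
  \<open>1 - s\<close>, which ends at \<open>Gamma (n + 2)\<close>.\<close>

lemma fact_le_Gamma_interpolation:
  fixes s :: real
  assumes s: "0 \<le> s" "s \<le> 1"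
  shows "fact n * (real n + 1) powr s \<le> 2 * Gamma (real n + 1 + s)"
proof -
  let ?y = "real n + 1 + s"
  have G: "Gamma ?y > 0" using s by (intro Gamma_real_pos) auto
  have "fact (Suc n) = Gamma (?y + (1 - s))"
    using Gamma_fact[of "Suc n", where 'a = real] by (simp add: algebra_simps)
  also have "\<dots> \<le> Gamma ?y * ?y powr (1 - s)"
    using s by (intro Gamma_shift_le_powr) auto
  also have "\<dots> \<le> Gamma ?y * (2 * (real n + 1)) powr (1 - s)"
    using s G by (intro mult_left_mono powr_mono2) auto
  also have "\<dots> = Gamma ?y * (2 powr (1 - s) * (real n + 1) powr (1 - s))"
    by (subst powr_mult) auto
  also have "\<dots> \<le> Gamma ?y * (2 powr 1 * (real n + 1) powr (1 - s))"
    using s G by (intro mult_left_mono mult_right_mono powr_mono) auto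
  also have "\<dots> = (2 * Gamma ?y) * ((real n + 1) / (real n + 1) powr s)"
    by (simp add: powr_diff)
  finally have "fact n * (real n + 1) \<le> (2 * Gamma ?y) * (real n + 1) / (real n + 1) powr s"
    by (simp add: algebra_simps)
  then have "fact n * (real n + 1) * (real n + 1) powr s \<le> (2 * Gamma ?y) * (real n + 1)"
    by (simp add: pos_le_divide_eq)
  then have "(fact n * (real n + 1) powr s) * (real n + 1) \<le> (2 * Gamma ?y) * (real n + 1)"
    by (simp add: algebra_simps)
  then show ?thesis by (rule mult_right_le_imp_le) simp
qed

lemma powr_between:
  fixes q s :: real
  assumes "0 < q" "0 \<le> s" "s \<le> 1"
  shows "q powr s \<le> 1 + q" "q / (1 + q) \<le> q powr s"
proof -
  consider "q \<le> 1" | "q \<ge> 1" by linarith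
  then have "q powr s \<le> 1 + q \<and> q / (1 + q) \<le> q powr s"
  proof cases
    case 1
    have "q powr s \<le> 1" using 1 assms powr_le1 by auto
    moreover have "q powr 1 \<le> q powr s" using 1 assms by (intro powr_mono') auto
    moreover have "q / (1 + q) \<le> q" using assms by (simp add: field_simps)
    ultimately show ?thesis using assms by simp
  next
    case 2
    have "q powr s \<le> q powr 1" using 2 assms by (intro powr_mono) auto
    moreover have "1 \<le> q powr s" using 2 assms ge_one_powr_ge_zero by auto
    moreover have "q / (1 + q) \<le> 1" using assms by simp
    ultimately show ?thesis using assms(1) order_trans[of "q / (1 + q)" 1 "q powr s"]
      by (auto simp del: divide_le_eq_1_pos)
  qed
  then show "q powr s \<le> 1 + q" "q / (1 + q) \<le> q powr s" by auto
qed

text \<open>Between two consecutive integers the function \<open>u \<mapsto> x powr u / Gamma (u + 1)\<close> is comparable with the terms of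
  the exponential series at these integers.\<close>

lemma interpolated_exp_term_bounds:
  fixes x u :: real
  assumes x: "0 < x" and u: "real n \<le> u" "u \<le> real n + 1"
  shows "x powr u / Gamma (u + 1) \<le> 2 * (x ^ n / fact n + x ^ Suc n / fact (Suc n))"
    and "x ^ n / fact n * (x / (real n + 1 + x)) \<le> x powr u / Gamma (u + 1)"
proof -
  define s where "s = u - real n"
  have s: "0 \<le> s" "s \<le> 1" "u = real n + s" using u by (auto simp: s_def)
  define q where "q = x / (real n + 1)"
  have q: "q > 0" using x by (simp add: q_def)
  have G: "Gamma (u + 1) > 0" using u by (intro Gamma_real_pos) auto
  have xu: "x powr u = x ^ n * x powr s"
    using x s by (simp add: powr_add powr_realpow)
  have qs: "q powr s = x powr s / (real n + 1) powr s"
    using x by (simp add: q_def powr_divide)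
  have G1: "fact n * (real n + 1) powr s \<le> 2 * Gamma (u + 1)"
    using fact_le_Gamma_interpolation[OF s(1,2), of n] s(3) by (simp add: add_ac)
  have G2: "Gamma (u + 1) \<le> fact n * (real n + 1) powr s"
    using Gamma_shift_le_powr[of "real n + 1" s] s Gamma_fact[of n, where 'a = real]
    by (simp add: add_ac)
  have p: "(real n + 1) powr s > 0" by simp
  have "x powr u / Gamma (u + 1) \<le> x powr u / (fact n * (real n + 1) powr s / 2)"
    using G1 G p by (intro divide_left_mono) auto
  also have "\<dots> = 2 * (x ^ n / fact n) * q powr s"
    unfolding xu qs by simp
  also have "\<dots> \<le> 2 * (x ^ n / fact n) * (1 + q)"
    using x q s by (intro mult_left_mono powr_between) auto
  also have "\<dots> = 2 * (x ^ n / fact n + x ^ Suc n / fact (Suc n))"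
    unfolding q_def fact_Suc by (simp add: distrib_left add_divide_distrib add_ac mult_ac)
  finally show "x powr u / Gamma (u + 1) \<le> 2 * (x ^ n / fact n + x ^ Suc n / fact (Suc n))" .
  have "x / (real n + 1 + x) = q / (1 + q)"
  proof -
    have "1 + q = (real n + 1 + x) / (real n + 1)" unfolding q_def by (simp add: field_simps)
    then show ?thesis unfolding q_def by simp
  qed
  then have "x ^ n / fact n * (x / (real n + 1 + x)) \<le> x ^ n / fact n * q powr s"
    using powr_between(2)[OF q s(1,2)] x by (simp only:) (intro mult_left_mono, auto)
  also have "\<dots> = x powr u / (fact n * (real n + 1) powr s)"
    unfolding xu qs by simp
  also have "\<dots> \<le> x powr u / Gamma (u + 1)"
    using G2 G p by (intro divide_left_mono) auto
  finally show "x ^ n / fact n * (x / (real n + 1 + x)) \<le> x powr u / Gamma (u + 1)" .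
qed

lemma exp_terms_sums: "(\<lambda>n. (x::real) ^ n / fact n) sums exp x"
  using exp_converges[of x] by (simp add: field_simps)

lemma exp_terms_weighted_sums: "(\<lambda>n. real n * ((x::real) ^ n / fact n)) sums (x * exp x)"
proof -
  have "(\<lambda>n. x * (x ^ n / fact n)) sums (x * exp x)"
    by (intro sums_mult exp_terms_sums)
  moreover have "x * (x ^ n / fact n) = real (Suc n) * (x ^ Suc n / fact (Suc n))" for n
    unfolding fact_Suc of_nat_mult by (subst times_divide_eq_right) (simp del: of_nat_Suc)
  ultimately have "(\<lambda>n. real (Suc n) * (x ^ Suc n / fact (Suc n))) sums (x * exp x)"
    by simp
  then show ?thesis by (subst (asm) sums_Suc_iff) simp
qed

text \<open>An interval of length \<open>1\<close> contains at most \<open>1 / \<nu> + 1\<close> multiples of \<open>\<nu>\<close>.\<close>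

lemma card_floor_fibre_le:
  fixes \<nu> :: real
  assumes "0 < \<nu>"
  shows "finite {r. nat \<lfloor>\<nu> * real r\<rfloor> = n}"
    and "real (card {r. nat \<lfloor>\<nu> * real r\<rfloor> = n}) \<le> 1 / \<nu> + 1"
proof -
  let ?A = "{r. nat \<lfloor>\<nu> * real r\<rfloor> = n}"
  have sub: "int ` ?A \<subseteq> {\<lceil>real n / \<nu>\<rceil>..<\<lceil>(real n + 1) / \<nu>\<rceil>}"
  proof clarify
    fix r assume n: "n = nat \<lfloor>\<nu> * real r\<rfloor>"
    have "0 \<le> \<nu> * real r" using assms by simp
    then have "real n \<le> \<nu> * real r" "\<nu> * real r < real n + 1"
      unfolding n by linarith+
    then have "real n / \<nu> \<le> real r" "real r < (real n + 1) / \<nu>"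
      using assms by (auto simp: field_simps)
    then show "int r \<in> {\<lceil>real (nat \<lfloor>\<nu> * real r\<rfloor>) / \<nu>\<rceil>..<\<lceil>(real (nat \<lfloor>\<nu> * real r\<rfloor>) + 1) / \<nu>\<rceil>}"
      unfolding n by (auto simp: ceiling_le_iff less_ceiling_iff)
  qed
  then have fin: "finite (int ` ?A)" by (rule finite_subset) simp
  then show "finite ?A" by (rule finite_imageD) (auto simp: inj_on_def)
  have "card ?A = card (int ` ?A)" by (simp add: card_image)
  also have "\<dots> \<le> card {\<lceil>real n / \<nu>\<rceil>..<\<lceil>(real n + 1) / \<nu>\<rceil>}"
    using sub by (intro card_mono) auto
  also have "\<dots> = nat (\<lceil>(real n + 1) / \<nu>\<rceil> - \<lceil>real n / \<nu>\<rceil>)" by simp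
  finally have "real (card ?A) \<le> real (nat (\<lceil>(real n + 1) / \<nu>\<rceil> - \<lceil>real n / \<nu>\<rceil>))"
    by (simp only: of_nat_le_iff)
  moreover have "(real n + 1) / \<nu> = real n / \<nu> + 1 / \<nu>" by (simp add: add_divide_distrib)
  moreover have "1 / \<nu> > 0" using assms by simp
  ultimately show "real (card ?A) \<le> 1 / \<nu> + 1" by linarith
qed

text \<open>The Mittag-Leffler series at \<open>x powr \<nu>\<close> samples the interpolated exponential series at the
  multiples of \<open>\<nu>\<close>. Grouping these by their integer part compares it with a multiple of \<open>exp x\<close>.\<close>

lemma mittag_leffler_terms_upper:
  fixes x \<nu> :: real
  assumes x: "0 < x" and \<nu>: "0 < \<nu>"
  shows "summable (\<lambda>r. x powr (\<nu> * real r) / Gamma (\<nu> * real r + 1))"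
    and "(\<Sum>r. x powr (\<nu> * real r) / Gamma (\<nu> * real r + 1)) \<le> 4 * (1 / \<nu> + 1) * exp x"
proof -
  define g where "g r = x powr (\<nu> * real r) / Gamma (\<nu> * real r + 1)" for r
  define f where "f r = nat \<lfloor>\<nu> * real r\<rfloor>" for r
  define h where "h n = 2 * (x ^ n / fact n + x ^ Suc n / fact (Suc n))" for n
  have h0: "h n \<ge> 0" for n using x by (simp add: h_def)
  have g0: "g r \<ge> 0" for r
    unfolding g_def using \<nu> by (intro divide_nonneg_nonneg less_imp_le[OF Gamma_real_pos])
      (auto intro: add_nonneg_pos)
  have gh: "g r \<le> h (f r)" for r
  proof -
    have "0 \<le> \<nu> * real r" using \<nu> by simp
    then have "real (f r) \<le> \<nu> * real r" "\<nu> * real r \<le> real (f r) + 1"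
      unfolding f_def by linarith+
    then show ?thesis unfolding g_def h_def by (intro interpolated_exp_term_bounds x)
  qed
  have "(\<lambda>n. x ^ Suc n / fact (Suc n)) sums (exp x - 1)"
    using exp_terms_sums[of x] by (subst sums_Suc_iff) simp
  then have "h sums (2 * (exp x + (exp x - 1)))"
    unfolding h_def by (intro sums_mult sums_add exp_terms_sums)
  then have hs: "summable h" "suminf h \<le> 4 * exp x"
    by (auto simp: sums_iff)
  have part: "(\<Sum>r<R. g r) \<le> 4 * (1 / \<nu> + 1) * exp x" for R
  proof -
    have "(\<Sum>r<R. g r) \<le> (\<Sum>r<R. h (f r))" by (intro sum_mono gh)
    also have "\<dots> = (\<Sum>n\<in>f ` {..<R}. \<Sum>r\<in>{r \<in> {..<R}. f r = n}. h (f r))"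
      by (rule sum.image_gen) simp
    also have "\<dots> = (\<Sum>n\<in>f ` {..<R}. real (card {r \<in> {..<R}. f r = n}) * h n)"
      by (intro sum.cong) auto
    also have "\<dots> \<le> (\<Sum>n\<in>f ` {..<R}. (1 / \<nu> + 1) * h n)"
    proof (intro sum_mono mult_right_mono h0)
      fix n
      have "card {r \<in> {..<R}. f r = n} \<le> card {r. f r = n}"
        using card_floor_fibre_le(1)[OF \<nu>, of n] by (intro card_mono) (auto simp: f_def)
      then show "real (card {r \<in> {..<R}. f r = n}) \<le> 1 / \<nu> + 1"
        using card_floor_fibre_le(2)[OF \<nu>, of n] by (simp add: f_def)
    qed
    also have "\<dots> = (1 / \<nu> + 1) * (\<Sum>n\<in>f ` {..<R}. h n)" by (simp add: sum_distrib_left)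
    also have "\<dots> \<le> (1 / \<nu> + 1) * (4 * exp x)"
      using \<nu> sum_le_suminf[OF hs(1), of "f ` {..<R}"] h0 hs(2)
      by (intro mult_left_mono) auto
    finally show ?thesis by (simp add: algebra_simps)
  qed
  show "summable g" by (rule summableI_nonneg_bounded[OF g0 part])
  then show "suminf g \<le> 4 * (1 / \<nu> + 1) * exp x" by (rule suminf_le_const) (rule part)
qed

text \<open>As \<open>\<nu> \<le> 1\<close>, every \<open>[n, n + 1)\<close> contains a multiple of \<open>\<nu>\<close>, so the series dominates
  \<open>\<Sum>n. x ^ n / fact n * (x / (n + 1 + x))\<close>. That is \<open>exp x\<close> times the mean of \<open>x / (N + 1 + x)\<close> for a
  Poisson variable \<open>N\<close> with mean \<open>x\<close>, and Jensen's inequality bounds the mean below by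
  \<open>x / (2 * x + 1)\<close>.\<close>

lemma mittag_leffler_terms_lower:
  fixes x \<nu> :: real
  assumes x: "1 \<le> x" and \<nu>: "0 < \<nu>" "\<nu> \<le> 1"
  shows "exp x / 3 \<le> (\<Sum>r. x powr (\<nu> * real r) / Gamma (\<nu> * real r + 1))"
proof -
  define g where "g r = x powr (\<nu> * real r) / Gamma (\<nu> * real r + 1)" for r
  define r where "r n = nat \<lceil>real n / \<nu>\<rceil>" for n
  define c where "c = 2 * x + 1"
  have c: "c > 0" using x by (simp add: c_def)
  have g0: "g r \<ge> 0" for r
    unfolding g_def using \<nu> by (intro divide_nonneg_nonneg less_imp_le[OF Gamma_real_pos])
      (auto intro: add_nonneg_pos)
  have rn: "real n \<le> \<nu> * real (r n)" "\<nu> * real (r n) < real n + 1" for n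
  proof -
    have "0 \<le> real n / \<nu>" using \<nu> by simp
    then have "real n / \<nu> \<le> real (r n)" "real (r n) < real n / \<nu> + 1"
      unfolding r_def by linarith+
    then show "real n \<le> \<nu> * real (r n)" "\<nu> * real (r n) < real n + 1"
      using \<nu> by (auto simp: field_simps)
  qed
  have inj: "inj_on r A" for A
  proof (rule inj_onI)
    fix m n assume "r m = r n"
    then show "m = n" using rn[of m] rn[of n] by auto
  qed
  have sm: "summable g"
    unfolding g_def using x \<nu> by (intro mittag_leffler_terms_upper) auto
  \<comment> \<open>Jensen's inequality is made explicit by the tangent of \<open>y \<mapsto> 1 / y\<close> at \<open>c\<close>, the mean of
    \<open>N + 1 + x\<close>\<close>
  have low: "x ^ n / fact n * (x * (2 / c - (real n + 1 + x) / c\<^sup>2)) \<le> g (r n)" for n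
  proof -
    let ?y = "real n + 1 + x"
    have y: "?y > 0" using x by auto
    have "0 \<le> (?y - c)\<^sup>2" by simp
    then have "2 / c - ?y / c\<^sup>2 \<le> 1 / ?y"
      using c y by (simp add: field_simps power2_eq_square)
    then have "x * (2 / c - ?y / c\<^sup>2) \<le> x / ?y"
      using x mult_left_mono[of "2 / c - ?y / c\<^sup>2" "1 / ?y" x] by simp
    then have "x ^ n / fact n * (x * (2 / c - ?y / c\<^sup>2)) \<le> x ^ n / fact n * (x / ?y)"
      using x by (intro mult_left_mono) auto
    also have "\<dots> \<le> g (r n)"
      unfolding g_def using x rn[of n] by (intro interpolated_exp_term_bounds) auto
    finally show ?thesis .
  qed
  have "(\<lambda>n. x * (2 / c - (1 + x) / c\<^sup>2) * (x ^ n / fact n) - x / c\<^sup>2 * (real n * (x ^ n / fact n)))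
      sums (x * (2 / c - (1 + x) / c\<^sup>2) * exp x - x / c\<^sup>2 * (x * exp x))"
    by (intro sums_diff sums_mult exp_terms_sums exp_terms_weighted_sums)
  moreover have "x * (2 / c - (1 + x) / c\<^sup>2) * (x ^ n / fact n) - x / c\<^sup>2 * (real n * (x ^ n / fact n))
      = x ^ n / fact n * (x * (2 / c - (real n + 1 + x) / c\<^sup>2))" for n
    by (simp add: field_simps add_divide_distrib)
  moreover have "x * (2 / c - (1 + x) / c\<^sup>2) * exp x - x / c\<^sup>2 * (x * exp x) = exp x * (x / c)"
  proof -
    have "2 / c - (1 + x) / c\<^sup>2 - x / c\<^sup>2 = 2 / c - c / c\<^sup>2"
      by (simp add: c_def add_divide_distrib)
    also have "\<dots> = 1 / c" using c by (simp add: field_simps power2_eq_square)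
    finally have "x * exp x * (2 / c - (1 + x) / c\<^sup>2 - x / c\<^sup>2) = x * exp x * (1 / c)" by simp
    then show ?thesis by (simp add: algebra_simps)
  qed
  ultimately have "(\<lambda>n. x ^ n / fact n * (x * (2 / c - (real n + 1 + x) / c\<^sup>2))) sums (exp x * (x / c))"
    by simp
  then have "(\<lambda>N. \<Sum>n<N. x ^ n / fact n * (x * (2 / c - (real n + 1 + x) / c\<^sup>2)))
      \<longlonglongrightarrow> exp x * (x / c)" by (simp add: sums_def)
  moreover have "(\<Sum>n<N. x ^ n / fact n * (x * (2 / c - (real n + 1 + x) / c\<^sup>2))) \<le> suminf g" for N
  proof -
    have "(\<Sum>n<N. x ^ n / fact n * (x * (2 / c - (real n + 1 + x) / c\<^sup>2))) \<le> (\<Sum>n<N. g (r n))"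
      by (intro sum_mono low)
    also have "\<dots> = (\<Sum>k\<in>r ` {..<N}. g k)" using inj by (simp add: sum.reindex)
    also have "\<dots> \<le> suminf g" using sm g0 by (intro sum_le_suminf) auto
    finally show ?thesis .
  qed
  ultimately have "exp x * (x / c) \<le> suminf g"
    by (intro LIMSEQ_le_const2) auto
  moreover have "1 / 3 \<le> x / c" using x by (simp add: c_def field_simps)
  then have "exp x * (1 / 3) \<le> exp x * (x / c)" by (intro mult_left_mono) auto
  ultimately show ?thesis unfolding g_def by linarith
qed

lemma mittag_leffler_term_eq:
  assumes "0 < z" "0 < \<nu>"
  shows "z ^ r / Gamma (\<nu> * real r + 1) = (z powr (1 / \<nu>)) powr (\<nu> * real r) / Gamma (\<nu> * real r + 1)"
  using assms by (simp add: powr_powr powr_realpow)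

lemma mittag_leffler_summable:
  assumes "0 < z" "0 < \<nu>"
  shows "summable (\<lambda>r. z ^ r / Gamma (\<nu> * real r + 1))"
  using mittag_leffler_terms_upper(1)[of "z powr (1 / \<nu>)" \<nu>] assms
  by (simp add: mittag_leffler_term_eq)

lemma mittag_leffler_pos:
  assumes "0 < z" "0 < \<nu>"
  shows "0 < mittag_leffler \<nu> 1 z"
  unfolding mittag_leffler_def using assms
  by (intro suminf_pos mittag_leffler_summable divide_pos_pos Gamma_real_pos)
    (auto intro: add_nonneg_pos)

lemma ln_mittag_leffler_asymp:
  assumes \<nu>: "0 < \<nu>" "\<nu> \<le> 1"
  shows "\<exists>K. \<forall>z\<ge>1. \<bar>ln (mittag_leffler \<nu> 1 z) - z powr (1 / \<nu>)\<bar> \<le> K"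
proof (intro exI allI impI)
  fix z :: real assume z: "1 \<le> z"
  define x where "x = z powr (1 / \<nu>)"
  have x: "1 \<le> x" using z \<nu> by (simp add: x_def ge_one_powr_ge_zero)
  define E where "E = mittag_leffler \<nu> 1 z"
  have E: "E = (\<Sum>r. x powr (\<nu> * real r) / Gamma (\<nu> * real r + 1))"
    unfolding E_def mittag_leffler_def x_def using z \<nu> by (simp add: mittag_leffler_term_eq)
  have E0: "E > 0" unfolding E_def using z \<nu> by (intro mittag_leffler_pos) auto
  have "E \<le> 4 * (1 / \<nu> + 1) * exp x"
    unfolding E using x \<nu> by (intro mittag_leffler_terms_upper) auto
  then have "ln E \<le> ln (4 * (1 / \<nu> + 1) * exp x)" using E0 by simp
  also have "4 * (1 / \<nu> + 1) \<noteq> 0" using \<nu> add_pos_pos[of "1 / \<nu>" 1] by simp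
  then have "ln (4 * (1 / \<nu> + 1) * exp x) = ln (4 * (1 / \<nu> + 1)) + x"
    by (subst ln_mult) auto
  finally have up: "ln E \<le> ln (4 * (1 / \<nu> + 1)) + x" .
  have "exp x / 3 \<le> E" unfolding E by (intro mittag_leffler_terms_lower x \<nu>)
  then have "ln (exp x / 3) \<le> ln E" using E0 by (subst ln_le_cancel_iff) auto
  then have "x - ln 3 \<le> ln E" by (simp add: ln_div)
  then show "\<bar>ln (mittag_leffler \<nu> 1 z) - z powr (1 / \<nu>)\<bar> \<le> \<bar>ln (4 * (1 / \<nu> + 1))\<bar> + ln 3"
    using up ln_ge_zero[of "3::real"] unfolding E_def x_def by linarith
qed

section \<open>The law at a fixed time\<close>

lemma finite_vsum_eq: "finite {k :: nat ^ 'm::finite. vsum k = n}"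
proof (rule finite_subset)
  show "{k :: nat ^ 'm. vsum k = n} \<subseteq> vec_lambda ` (UNIV \<rightarrow>\<^sub>E {..n})"
  proof clarify
    fix k :: "nat ^ 'm"
    have "k $ i \<le> vsum k" for i
      unfolding vsum_def by (rule member_le_sum) auto
    then have "vec_nth k \<in> UNIV \<rightarrow>\<^sub>E {..vsum k}" by auto
    moreover have "k = vec_lambda (vec_nth k)" by simp
    ultimately show "k \<in> vec_lambda ` (UNIV \<rightarrow>\<^sub>E {..vsum k})" by blast
  qed
qed (auto intro!: finite_imageI finite_PiE)

lemma vsum_add_axis: "vsum (k + axis i 1 :: nat ^ 'm::finite) = Suc (vsum k)"
  by (simp add: vsum_def axis_def sum.distrib)

lemma monomial_add_axis:
  fixes x :: "real ^ 'm::finite"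
  shows "real ((k + axis i 1) $ i) * (\<Prod>l\<in>UNIV. x $ l ^ ((k + axis i 1) $ l) / fact ((k + axis i 1) $ l))
    = x $ i * (\<Prod>l\<in>UNIV. x $ l ^ (k $ l) / fact (k $ l))"
proof -
  have "(\<Prod>l\<in>UNIV - {i}. x $ l ^ ((k + axis i 1) $ l) / fact ((k + axis i 1) $ l))
      = (\<Prod>l\<in>UNIV - {i}. x $ l ^ (k $ l) / fact (k $ l))"
    by (intro prod.cong) (auto simp: axis_def)
  moreover have "real ((k + axis i 1) $ i) * (x $ i ^ ((k + axis i 1) $ i) / fact ((k + axis i 1) $ i))
      = x $ i * (x $ i ^ (k $ i) / fact (k $ i))"
    by (simp add: axis_def del: of_nat_Suc)
  ultimately show ?thesis
    by (simp only: prod.remove[OF finite UNIV_I, of _ i] mult.assoc[symmetric])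
qed

text \<open>The multinomial theorem with the factorial of the degree divided out. In the induction, multiply the
  sum in degree \<open>Suc n\<close> by \<open>Suc n = (\<Sum>i. k $ i)\<close>: the \<open>i\<close>-th part has its exponent \<open>k $ i\<close>
  cancelled against the factorial, and shifting \<open>k\<close> by \<open>axis i 1\<close> turns it into \<open>x $ i\<close> times the sum in
  degree \<open>n\<close>.\<close>

lemma multinomial_sum:
  fixes x :: "real ^ 'm::finite"
  shows "(\<Sum>k | vsum k = n. \<Prod>i\<in>UNIV. x $ i ^ (k $ i) / fact (k $ i)) = vsum x ^ n / fact n"
proof (induction n)
  case 0
  have "{k :: nat ^ 'm. vsum k = 0} = {0}" by (auto simp: vsum_def vec_eq_iff)
  then show ?case by simp
next
  case (Suc n)
  define w where "w k = (\<Prod>i\<in>UNIV. x $ i ^ (k $ i) / fact (k $ i))" for k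
  have shift: "(\<Sum>k | vsum k = Suc n. real (k $ i) * w k) = (\<Sum>k | vsum k = n. x $ i * w k)" for i
  proof -
    have "(\<Sum>k | vsum k = Suc n. real (k $ i) * w k) = (\<Sum>k | vsum k = Suc n \<and> k $ i > 0. real (k $ i) * w k)"
      by (rule sum.mono_neutral_right) (auto simp: finite_vsum_eq)
    also have "\<dots> = (\<Sum>k | vsum k = n. real ((k + axis i 1) $ i) * w (k + axis i 1))"
    proof (rule sum.reindex_bij_witness[of _ "\<lambda>k. k + axis i 1" "\<lambda>k. \<chi> l. k $ l - axis i 1 $ l"])
      fix k :: "nat ^ 'm" assume k: "k \<in> {k. vsum k = Suc n \<and> 0 < k $ i}"
      then show eq: "(\<chi> l. k $ l - axis i 1 $ l) + axis i 1 = k"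
        by (auto simp: vec_eq_iff axis_def)
      have "vsum ((\<chi> l. k $ l - axis i 1 $ l) + axis i 1) = Suc n"
        using k unfolding eq by simp
      then show "(\<chi> l. k $ l - axis i 1 $ l) \<in> {k. vsum k = n}"
        unfolding vsum_add_axis by simp
      show "real (((\<chi> l. k $ l - axis i 1 $ l) + axis i 1) $ i) * w ((\<chi> l. k $ l - axis i 1 $ l) + axis i 1)
          = real (k $ i) * w k"
        unfolding eq ..
    next
      fix k :: "nat ^ 'm" assume "k \<in> {k. vsum k = n}"
      then show "k + axis i 1 \<in> {k. vsum k = Suc n \<and> 0 < k $ i}"
        using vsum_add_axis[of k i] by (simp add: axis_def)
      show "(\<chi> l. (k + axis i 1) $ l - axis i 1 $ l) = k" by (simp add: vec_eq_iff)
    qed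
    also have "\<dots> = (\<Sum>k | vsum k = n. x $ i * w k)"
      unfolding w_def monomial_add_axis ..
    finally show ?thesis .
  qed
  have "real (Suc n) * (\<Sum>k | vsum k = Suc n. w k) = (\<Sum>k | vsum k = Suc n. \<Sum>i\<in>UNIV. real (k $ i) * w k)"
    unfolding sum_distrib_left
    by (intro sum.cong) (auto simp: sum_distrib_right[symmetric] vsum_def
        simp del: of_nat_Suc of_nat_sum simp flip: of_nat_sum)
  also have "\<dots> = (\<Sum>i\<in>UNIV. \<Sum>k | vsum k = Suc n. real (k $ i) * w k)" by (rule sum.swap)
  also have "\<dots> = (\<Sum>i\<in>UNIV. x $ i * (vsum x ^ n / fact n))"
    unfolding shift using Suc by (simp add: w_def sum_distrib_left[symmetric])
  also have "\<dots> = vsum x ^ Suc n / fact n" by (simp add: vsum_def sum_distrib_right sum_divide_distrib)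
  finally show ?case
    unfolding w_def by (simp add: field_simps del: of_nat_Suc)
qed

lemma nn_integral_countable_valued:
  fixes X :: "'w \<Rightarrow> 'k::countable"
  assumes P: "prob_space P" and X: "X \<in> measurable P (count_space UNIV)"
  shows "(\<integral>\<^sup>+\<omega>. f (X \<omega>) \<partial>P) = (\<integral>\<^sup>+k. ennreal \<P>(\<omega> in P. X \<omega> = k) * f k \<partial>count_space UNIV)"
proof -
  interpret prob_space P by fact
  have "distr P (count_space UNIV) X = density (count_space UNIV) (\<lambda>k. ennreal \<P>(\<omega> in P. X \<omega> = k))"
  proof (rule measure_eqI_countable[where A = UNIV])
    fix k
    have "emeasure (distr P (count_space UNIV) X) {k} = emeasure P (X -` {k} \<inter> space P)"
      using X by (simp add: emeasure_distr)
    also have "X -` {k} \<inter> space P = {\<omega> \<in> space P. X \<omega> = k}" by auto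
    finally show "emeasure (distr P (count_space UNIV) X) {k}
        = emeasure (density (count_space UNIV) (\<lambda>k. ennreal \<P>(\<omega> in P. X \<omega> = k))) {k}"
      by (simp add: emeasure_density emeasure_eq_measure)
  qed auto
  then show ?thesis
    using X by (simp add: nn_integral_distr[symmetric] nn_integral_density)
qed

lemma nn_integral_count_space_group:
  fixes f :: "'k \<Rightarrow> ennreal" and s :: "'k \<Rightarrow> nat"
  assumes fin: "\<And>h. finite {k. s k = h}"
  shows "(\<integral>\<^sup>+k. f k \<partial>count_space UNIV) = (\<Sum>h. \<Sum>k | s k = h. f k)"
proof -
  have "(\<integral>\<^sup>+k. f k \<partial>count_space UNIV)
      = (\<integral>\<^sup>+k. (\<Sum>h. f k * indicator {k. s k = h} k) \<partial>count_space UNIV)"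
  proof (rule nn_integral_cong)
    fix k
    have "(\<Sum>h. f k * indicator {k. s k = h} k) = (\<Sum>h\<in>{s k}. f k * indicator {k. s k = h} k)"
      by (rule suminf_finite) auto
    then show "f k = (\<Sum>h. f k * indicator {k. s k = h} k)" by simp
  qed
  also have "\<dots> = (\<Sum>h. \<integral>\<^sup>+k. f k * indicator {k. s k = h} k \<partial>count_space UNIV)"
    by (rule nn_integral_suminf) simp
  also have "\<dots> = (\<Sum>h. \<Sum>k | s k = h. f k)"
    by (simp add: nn_integral_count_space_indicator[symmetric] nn_integral_count_space_finite fin)
  finally show ?thesis .
qed

definition exp_tilt :: "real ^ 'm::finite \<Rightarrow> real ^ 'm \<Rightarrow> real ^ 'm"
  where "exp_tilt lam \<theta> = (\<chi> i. lam $ i * exp (\<theta> $ i))"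

lemma vsum_exp_tilt_pos:
  assumes "\<And>i. 0 < lam $ i"
  shows "0 < vsum (exp_tilt lam \<theta>)"
  unfolding vsum_def exp_tilt_def using assms by (intro sum_pos) auto

lemma alt_frac_poisson_pmf_tilt:
  "alt_frac_poisson_pmf \<nu> lam t k * exp (\<theta> \<bullet> real_vec k)
   = (\<Prod>i\<in>UNIV. exp_tilt lam \<theta> $ i ^ (k $ i) / fact (k $ i))
     * (fact (vsum k) * (t powr \<nu>) ^ vsum k / Gamma (\<nu> * real (vsum k) + 1)
     / mittag_leffler \<nu> 1 (vsum lam * t powr \<nu>))"
proof -
  have "exp (\<theta> \<bullet> real_vec k) = (\<Prod>i\<in>UNIV. exp (\<theta> $ i) ^ (k $ i))"
    by (simp add: inner_vec_def real_vec_def exp_sum exp_of_nat_mult[symmetric] mult.commute)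
  then show ?thesis
    by (simp add: alt_frac_poisson_pmf_def exp_tilt_def power_mult_distrib prod_dividef
        prod.distrib mult_ac)
qed

text \<open>Multiplying the law by \<open>exp (\<theta> \<bullet> k)\<close> yields the unnormalised law with weights \<open>exp_tilt lam \<theta>\<close>, so
  its total mass is the Mittag-Leffler value that normalises the tilted law.\<close>

lemma alt_frac_poisson_mgf:
  fixes lam \<theta> :: "real ^ 'm::finite"
  assumes \<nu>: "0 < \<nu>" and lam: "\<And>i. 0 < lam $ i"
    and M: "alt_frac_poisson_process P \<nu> lam M" and t: "0 < t"
  shows "(\<integral>\<^sup>+\<omega>. ennreal (exp (\<theta> \<bullet> real_vec (M t \<omega>))) \<partial>P)
    = ennreal (mittag_leffler \<nu> 1 (vsum (exp_tilt lam \<theta>) * t powr \<nu>)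
        / mittag_leffler \<nu> 1 (vsum lam * t powr \<nu>))"
proof -
  have P: "prob_space P" and X: "M t \<in> measurable P (count_space UNIV)"
    and pmf: "\<And>k. \<P>(\<omega> in P. M t \<omega> = k) = alt_frac_poisson_pmf \<nu> lam t k"
    using M t by (auto simp: alt_frac_poisson_process_def)
  define S where "S = vsum (exp_tilt lam \<theta>)"
  define E where "E = mittag_leffler \<nu> 1 (vsum lam * t powr \<nu>)"
  define c where "c h = fact h * (t powr \<nu>) ^ h / Gamma (\<nu> * real h + 1) / E" for h
  have S: "S > 0" unfolding S_def by (intro vsum_exp_tilt_pos lam)
  have "vsum lam > 0" unfolding vsum_def using lam by (intro sum_pos) auto
  then have E: "E > 0" unfolding E_def using \<nu> t by (intro mittag_leffler_pos) auto
  have G: "Gamma (\<nu> * real h + 1) > 0" for h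
    using \<nu> by (intro Gamma_real_pos) (auto intro: add_nonneg_pos)
  have c: "c h \<ge> 0" for h unfolding c_def using E G[of h] by auto
  define w where "w k = (\<Prod>i\<in>UNIV. exp_tilt lam \<theta> $ i ^ (k $ i) / fact (k $ i))" for k
  have w: "w k \<ge> 0" for k
    unfolding w_def exp_tilt_def using lam by (intro prod_nonneg) (auto simp: less_imp_le)
  have "(\<integral>\<^sup>+\<omega>. ennreal (exp (\<theta> \<bullet> real_vec (M t \<omega>))) \<partial>P)
      = (\<integral>\<^sup>+k. ennreal (alt_frac_poisson_pmf \<nu> lam t k) * ennreal (exp (\<theta> \<bullet> real_vec k)) \<partial>count_space UNIV)"
    by (subst nn_integral_countable_valued[OF P X]) (simp add: pmf)
  also have "\<dots> = (\<integral>\<^sup>+k. ennreal (w k * c (vsum k)) \<partial>count_space UNIV)"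
    by (simp add: ennreal_mult''[symmetric] alt_frac_poisson_pmf_tilt w_def c_def E_def)
  also have "\<dots> = (\<Sum>h. \<Sum>k | vsum k = h. ennreal (w k * c (vsum k)))"
    by (rule nn_integral_count_space_group) (rule finite_vsum_eq)
  also have "\<dots> = (\<Sum>h. ennreal ((S * t powr \<nu>) ^ h / Gamma (\<nu> * real h + 1) / E))"
  proof (intro suminf_cong)
    fix h
    have "(\<Sum>k | vsum k = h. ennreal (w k * c (vsum k))) = ennreal (\<Sum>k | vsum k = h. w k * c h)"
      using w c by (subst sum_ennreal[symmetric]) (auto intro!: sum.cong)
    also have "(\<Sum>k | vsum k = h. w k * c h) = S ^ h / fact h * c h"
      unfolding w_def S_def sum_distrib_right[symmetric] multinomial_sum ..
    also have "\<dots> = (S * t powr \<nu>) ^ h / Gamma (\<nu> * real h + 1) / E"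
      by (simp add: c_def power_mult_distrib)
    finally show "(\<Sum>k | vsum k = h. ennreal (w k * c (vsum k)))
      = ennreal ((S * t powr \<nu>) ^ h / Gamma (\<nu> * real h + 1) / E)" .
  qed
  also have "\<dots> = ennreal (\<Sum>h. (S * t powr \<nu>) ^ h / Gamma (\<nu> * real h + 1) / E)"
    using S t \<nu> E less_imp_le[OF G]
    by (intro suminf_ennreal2 summable_divide mittag_leffler_summable) auto
  also have "(\<Sum>h. (S * t powr \<nu>) ^ h / Gamma (\<nu> * real h + 1) / E)
      = mittag_leffler \<nu> 1 (S * t powr \<nu>) / E"
    unfolding mittag_leffler_def using S t \<nu>
    by (intro suminf_divide mittag_leffler_summable) auto
  finally show ?thesis unfolding S_def E_def .
qed

section \<open>The limiting quadratic form\<close>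

lemma inner_cov_matrix:
  fixes lam x y :: "real ^ 'm::finite"
  shows "x \<bullet> (cov_matrix \<nu> lam *v y)
    = 1 / \<nu> * (1 / \<nu> - 1) * vsum lam powr (1 / \<nu> - 2) * (lam \<bullet> x) * (lam \<bullet> y)
      + 1 / \<nu> * vsum lam powr (1 / \<nu> - 1) * (\<Sum>i\<in>UNIV. lam $ i * x $ i * y $ i)"
proof -
  define A where "A = 1 / \<nu> * (1 / \<nu> - 1) * vsum lam powr (1 / \<nu> - 2)"
  define B where "B = 1 / \<nu> * vsum lam powr (1 / \<nu> - 1)"
  have C: "cov_matrix \<nu> lam $ j $ k = A * lam $ j * lam $ k + (if k = j then B * lam $ j else 0)" for j k
    by (simp add: cov_matrix_def A_def B_def power2_eq_square)
  have "(cov_matrix \<nu> lam *v y) $ j = A * lam $ j * (lam \<bullet> y) + B * lam $ j * y $ j" for j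
  proof -
    have "(cov_matrix \<nu> lam *v y) $ j
        = (\<Sum>k\<in>UNIV. A * lam $ j * (lam $ k * y $ k) + (if k = j then B * lam $ j * y $ j else 0))"
      by (auto simp: matrix_vector_mult_def C algebra_simps intro!: sum.cong)
    then show ?thesis by (simp add: sum.distrib sum_distrib_left[symmetric] inner_vec_def)
  qed
  then have "x \<bullet> (cov_matrix \<nu> lam *v y)
      = (\<Sum>j\<in>UNIV. A * (lam \<bullet> y) * (lam $ j * x $ j) + B * (lam $ j * x $ j * y $ j))"
    by (simp add: inner_vec_def algebra_simps)
  also have "\<dots> = A * (lam \<bullet> y) * (lam \<bullet> x) + B * (\<Sum>i\<in>UNIV. lam $ i * x $ i * y $ i)"
    by (simp add: sum.distrib sum_distrib_left[symmetric] inner_vec_def)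
  finally show ?thesis by (simp add: A_def B_def mult_ac)
qed

lemma Lambda_tilde_has_derivative:
  "(Lambda_tilde \<nu> lam has_derivative (\<lambda>h. h \<bullet> (cov_matrix \<nu> lam *v \<eta>))) (at \<eta>)"
proof -
  let ?C = "cov_matrix \<nu> lam"
  have "((*v) ?C has_derivative (*v) ?C) (at \<eta>)"
    by (intro bounded_linear_imp_has_derivative matrix_vector_mul_bounded_linear)
  then have "((\<lambda>\<theta>. 1 / 2 * (\<theta> \<bullet> (?C *v \<theta>))) has_derivative
      (\<lambda>h. 1 / 2 * (\<eta> \<bullet> (?C *v h) + h \<bullet> (?C *v \<eta>)))) (at \<eta>)"
    by (intro has_derivative_mult_right has_derivative_inner has_derivative_ident)
  moreover have "\<eta> \<bullet> (?C *v h) = h \<bullet> (?C *v \<eta>)" for h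
    by (simp add: inner_cov_matrix mult_ac)
  ultimately show ?thesis by (simp add: Lambda_tilde_def[abs_def])
qed

text \<open>The first part of the quadratic form is a nonnegative multiple of a square because \<open>\<nu> \<le> 1\<close>; the
  second is positive definite because all \<open>lam $ i\<close> are positive. So the matrix has trivial kernel.\<close>

lemma surj_cov_matrix:
  fixes lam :: "real ^ 'm::finite"
  assumes \<nu>: "0 < \<nu>" "\<nu> \<le> 1" and lam: "\<And>i. 0 < lam $ i"
  shows "surj ((*v) (cov_matrix \<nu> lam))"
proof -
  let ?C = "cov_matrix \<nu> lam"
  have vs: "0 < vsum lam" unfolding vsum_def using lam by (intro sum_pos) auto
  have "x = 0" if "?C *v x = 0" for x
  proof -
    have "0 = x \<bullet> (?C *v x)" using that by simp
    also have "\<dots> = 1 / \<nu> * (1 / \<nu> - 1) * vsum lam powr (1 / \<nu> - 2) * (lam \<bullet> x)\<^sup>2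
      + 1 / \<nu> * vsum lam powr (1 / \<nu> - 1) * (\<Sum>i\<in>UNIV. lam $ i * (x $ i)\<^sup>2)"
      by (simp add: inner_cov_matrix power2_eq_square mult_ac)
    finally have "1 / \<nu> * vsum lam powr (1 / \<nu> - 1) * (\<Sum>i\<in>UNIV. lam $ i * (x $ i)\<^sup>2) \<le> 0"
    proof -
      assume eq: "0 = 1 / \<nu> * (1 / \<nu> - 1) * vsum lam powr (1 / \<nu> - 2) * (lam \<bullet> x)\<^sup>2
        + 1 / \<nu> * vsum lam powr (1 / \<nu> - 1) * (\<Sum>i\<in>UNIV. lam $ i * (x $ i)\<^sup>2)"
      have "0 \<le> 1 / \<nu> * (1 / \<nu> - 1) * vsum lam powr (1 / \<nu> - 2) * (lam \<bullet> x)\<^sup>2"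
        using \<nu> by (intro mult_nonneg_nonneg) auto
      then show ?thesis using eq by linarith
    qed
    moreover have "0 < 1 / \<nu> * vsum lam powr (1 / \<nu> - 1)" using \<nu> vs by simp
    ultimately have "(\<Sum>i\<in>UNIV. lam $ i * (x $ i)\<^sup>2) \<le> 0" by (metis mult_pos_pos not_le)
    moreover have "\<And>i. 0 \<le> lam $ i * (x $ i)\<^sup>2" using lam by (simp add: less_imp_le)
    ultimately have "(\<Sum>i\<in>UNIV. lam $ i * (x $ i)\<^sup>2) = 0" and nonneg: "\<And>i. 0 \<le> lam $ i * (x $ i)\<^sup>2"
      by (simp_all only: order_antisym sum_nonneg)
    then have "\<forall>i\<in>UNIV. lam $ i * (x $ i)\<^sup>2 = 0"
      by (simp only: sum_nonneg_eq_0_iff[OF finite nonneg])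
    then have "x $ i = 0" for i using lam[of i] by (metis UNIV_I less_irrefl mult_eq_0_iff power_eq_0_iff)
    then show ?thesis by (simp add: vec_eq_iff)
  qed
  then have "inj ((*v) ?C)"
    by (simp add: linear_injective_0[OF matrix_vector_mul_linear])
  then show ?thesis
    by (intro linear_injective_imp_surjective matrix_vector_mul_linear) auto
qed

text \<open>The coefficient \<open>d\<close> is the derivative at \<open>0\<close>, to be cancelled by the mean. With
  \<open>S x = (\<Sum>i. lam $ i * exp (x * \<theta> $ i))\<close> the second derivative at \<open>0\<close> involves
  \<open>S' 0 = lam \<bullet> \<theta>\<close> squared and \<open>S'' 0 = (\<Sum>i. lam $ i * (\<theta> $ i)\<^sup>2)\<close>, the two parts of the
  quadratic form of \<open>cov_matrix\<close>.\<close>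

lemma tilted_total_rate_second_order:
  fixes lam \<theta> :: "real ^ 'm::finite" and \<nu> :: real
  assumes lam: "\<And>i. 0 < lam $ i"
  defines "\<psi> \<equiv> \<lambda>x. vsum (exp_tilt lam (x *\<^sub>R \<theta>)) powr (1 / \<nu>)"
  obtains d where "((\<lambda>x. (\<psi> x - \<psi> 0 - x * d) / x\<^sup>2) \<longlongrightarrow> Lambda_tilde \<nu> lam \<theta>) (at 0)"
proof -
  define S where "S x = (\<Sum>i\<in>UNIV. lam $ i * exp (x * \<theta> $ i))" for x
  define S1 where "S1 x = (\<Sum>i\<in>UNIV. lam $ i * (\<theta> $ i * exp (x * \<theta> $ i)))" for x
  define S2 where "S2 x = (\<Sum>i\<in>UNIV. lam $ i * (\<theta> $ i * (\<theta> $ i * exp (x * \<theta> $ i))))" for x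
  define \<psi>' where "\<psi>' x = 1 / \<nu> * S x powr (1 / \<nu> - 1) * S1 x" for x
  have S: "vsum (exp_tilt lam (x *\<^sub>R \<theta>)) = S x" for x
    by (simp add: vsum_def exp_tilt_def S_def)
  have S_pos: "S x > 0" for x unfolding S[symmetric] by (rule vsum_exp_tilt_pos[OF lam])
  have dS: "(S has_real_derivative S1 x) (at x)" for x
    unfolding S_def[abs_def] S1_def by (auto intro!: derivative_eq_intros sum.cong)
  have dS1: "(S1 has_real_derivative S2 x) (at x)" for x
    unfolding S1_def[abs_def] S2_def by (auto intro!: derivative_eq_intros sum.cong)
  have powr: "((\<lambda>x. S x powr p) has_real_derivative p * S x powr (p - 1) * S1 x) (at x)" for p x
    using DERIV_fun_powr[OF dS S_pos, of p x] by simp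
  have "((\<lambda>x. (\<psi> x - \<psi> 0 - x * \<psi>' 0) / x\<^sup>2) \<longlongrightarrow>
      (1 / \<nu> * ((1 / \<nu> - 1) * S 0 powr (1 / \<nu> - 1 - 1) * S1 0) * S1 0
        + 1 / \<nu> * S 0 powr (1 / \<nu> - 1) * S2 0) / 2) (at 0)"
  proof (rule second_order_difference_quotient)
    show "(\<psi> has_real_derivative \<psi>' x) (at x)" for x
      unfolding \<psi>_def S \<psi>'_def by (rule powr)
    show "(\<psi>' has_real_derivative 1 / \<nu> * ((1 / \<nu> - 1) * S 0 powr (1 / \<nu> - 1 - 1) * S1 0) * S1 0
        + 1 / \<nu> * S 0 powr (1 / \<nu> - 1) * S2 0) (at 0)"
      unfolding \<psi>'_def[abs_def]
      using DERIV_mult[OF DERIV_cmult[OF powr, of "1 / \<nu>" "1 / \<nu> - 1" 0] dS1]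
      by (rule DERIV_cong) (simp only: mult_ac)
  qed
  also have "(1 / \<nu> * ((1 / \<nu> - 1) * S 0 powr (1 / \<nu> - 1 - 1) * S1 0) * S1 0
        + 1 / \<nu> * S 0 powr (1 / \<nu> - 1) * S2 0) / 2 = Lambda_tilde \<nu> lam \<theta>"
    unfolding Lambda_tilde_def inner_cov_matrix S_def S1_def S2_def
    by (simp add: vsum_def inner_vec_def mult_ac add_divide_distrib)
  finally show ?thesis by (rule that)
qed

section \<open>Moderate deviations of the process\<close>

locale alt_frac_poisson =
  fixes P :: "'w measure" and \<nu> :: real and lam :: "real ^ 'm::finite"
    and M :: "real \<Rightarrow> 'w \<Rightarrow> nat ^ 'm"
  assumes \<nu>: "0 < \<nu>" "\<nu> \<le> 1" and lam: "\<And>i. 0 < lam $ i"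
    and process: "alt_frac_poisson_process P \<nu> lam M"
begin

sublocale prob_space P
  using process by (simp add: alt_frac_poisson_process_def)

text \<open>The argument of the Mittag-Leffler function in the moment generating function at \<open>\<theta>\<close>.\<close>

definition tilted_argument :: "real ^ 'm \<Rightarrow> real \<Rightarrow> real"
  where "tilted_argument \<theta> t = vsum (exp_tilt lam \<theta>) * t powr \<nu>"

definition log_mgf :: "real ^ 'm \<Rightarrow> real \<Rightarrow> real"
  where "log_mgf \<theta> t = ln (mittag_leffler \<nu> 1 (tilted_argument \<theta> t))
    - ln (mittag_leffler \<nu> 1 (tilted_argument 0 t))"

lemma exp_tilt_zero: "exp_tilt lam 0 = lam"
  by (simp add: exp_tilt_def vec_eq_iff)

lemma tilted_argument_pos: "0 < t \<Longrightarrow> 0 < tilted_argument \<theta> t"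
  using vsum_exp_tilt_pos[OF lam] by (simp add: tilted_argument_def)

lemma M_measurable: "0 < t \<Longrightarrow> (\<lambda>\<omega>. f (M t \<omega>)) \<in> measurable P borel"
  using process measurable_compose[of "M t" P "count_space UNIV" f borel]
  by (simp add: alt_frac_poisson_process_def)

lemma mgf:
  assumes t: "0 < t"
  shows "integrable P (\<lambda>\<omega>. exp (\<theta> \<bullet> real_vec (M t \<omega>)))"
    and "expectation (\<lambda>\<omega>. exp (\<theta> \<bullet> real_vec (M t \<omega>))) = exp (log_mgf \<theta> t)"
proof -
  have pos: "0 < mittag_leffler \<nu> 1 (tilted_argument \<theta> t)" for \<theta>
    using tilted_argument_pos[OF t] \<nu> by (intro mittag_leffler_pos)
  have "(\<integral>\<^sup>+\<omega>. ennreal (exp (\<theta> \<bullet> real_vec (M t \<omega>))) \<partial>P) = ennreal (exp (log_mgf \<theta> t))"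
    using alt_frac_poisson_mgf[OF \<nu>(1) lam process t, of \<theta>] pos[of \<theta>] pos[of 0]
    by (simp add: log_mgf_def exp_diff tilted_argument_def exp_tilt_zero)
  moreover have "(\<lambda>\<omega>. exp (\<theta> \<bullet> real_vec (M t \<omega>))) \<in> borel_measurable P"
    by (rule M_measurable[OF t])
  ultimately have "integrable P (\<lambda>\<omega>. exp (\<theta> \<bullet> real_vec (M t \<omega>)))
      \<and> expectation (\<lambda>\<omega>. exp (\<theta> \<bullet> real_vec (M t \<omega>))) = exp (log_mgf \<theta> t)"
    by (subst nn_integral_eq_integrable[symmetric]) simp_all
  then show "integrable P (\<lambda>\<omega>. exp (\<theta> \<bullet> real_vec (M t \<omega>)))"
    "expectation (\<lambda>\<omega>. exp (\<theta> \<bullet> real_vec (M t \<omega>))) = exp (log_mgf \<theta> t)" by auto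
qed

lemma component_integrable:
  assumes t: "0 < t"
  shows "integrable P (\<lambda>\<omega>. real (M t \<omega> $ i))"
proof (rule Bochner_Integration.integrable_bound)
  show "integrable P (\<lambda>\<omega>. exp (axis i 1 \<bullet> real_vec (M t \<omega>)))" by (rule mgf(1)[OF t])
  show "AE \<omega> in P. norm (real (M t \<omega> $ i)) \<le> norm (exp (axis i 1 \<bullet> real_vec (M t \<omega>)))"
  proof (rule AE_I2)
    fix \<omega>
    show "norm (real (M t \<omega> $ i)) \<le> norm (exp (axis i 1 \<bullet> real_vec (M t \<omega>)))"
      using exp_ge_add_one_self[of "real (M t \<omega> $ i)"]
      by (simp add: inner_axis' real_vec_def del: exp_ge_add_one_self)
  qed
qed (rule M_measurable[OF t])

lemma inner_mean_vec:
  assumes t: "0 < t"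
  shows "integrable P (\<lambda>\<omega>. \<theta> \<bullet> real_vec (M t \<omega>))"
    and "expectation (\<lambda>\<omega>. \<theta> \<bullet> real_vec (M t \<omega>)) = \<theta> \<bullet> mean_vec P (M t)"
proof -
  have eq: "\<theta> \<bullet> real_vec (M t \<omega>) = (\<Sum>i\<in>UNIV. \<theta> $ i * real (M t \<omega> $ i))" for \<omega>
    by (simp add: inner_vec_def real_vec_def)
  have int: "integrable P (\<lambda>\<omega>. \<theta> $ i * real (M t \<omega> $ i))" for i
    by (rule integrable_mult_right[OF component_integrable[OF t]])
  show "integrable P (\<lambda>\<omega>. \<theta> \<bullet> real_vec (M t \<omega>))"
    unfolding eq by (rule Bochner_Integration.integrable_sum[OF int])
  show "expectation (\<lambda>\<omega>. \<theta> \<bullet> real_vec (M t \<omega>)) = \<theta> \<bullet> mean_vec P (M t)"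
    unfolding eq by (subst Bochner_Integration.integral_sum[OF int]) (simp add: inner_vec_def mean_vec_def)
qed

lemma inner_mean_vec_le_log_mgf:
  assumes t: "0 < t"
  shows "\<theta> \<bullet> mean_vec P (M t) \<le> log_mgf \<theta> t"
proof -
  have "exp (expectation (\<lambda>\<omega>. \<theta> \<bullet> real_vec (M t \<omega>)))
      \<le> expectation (\<lambda>\<omega>. exp (\<theta> \<bullet> real_vec (M t \<omega>)))"
    by (rule jensens_inequality[where q = exp and X = "\<lambda>\<omega>. \<theta> \<bullet> real_vec (M t \<omega>)" and I = UNIV])
      (simp_all add: inner_mean_vec(1)[OF t] mgf(1)[OF t] exp_convex)
  then show ?thesis by (simp add: inner_mean_vec(2) mgf(2) t)
qed

lemma log_mgf_asymp:
  shows "\<exists>K. \<forall>f. (f \<longlongrightarrow> 0) at_top \<longrightarrow> (\<forall>\<^sub>F t in at_top.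
    \<bar>log_mgf (f t *\<^sub>R \<theta>) t - t * (vsum (exp_tilt lam (f t *\<^sub>R \<theta>)) powr (1 / \<nu>)
      - vsum (exp_tilt lam (0 *\<^sub>R \<theta>)) powr (1 / \<nu>))\<bar> \<le> K)"
proof -
  obtain K where K: "\<And>z. 1 \<le> z \<Longrightarrow> \<bar>ln (mittag_leffler \<nu> 1 z) - z powr (1 / \<nu>)\<bar> \<le> K"
    using ln_mittag_leffler_asymp[OF \<nu>] by blast
  have large: "\<forall>\<^sub>F t in at_top. 1 \<le> tilted_argument (f t *\<^sub>R \<theta>) t" if f: "(f \<longlongrightarrow> 0) at_top" for f
  proof -
    have "((\<lambda>t. \<Sum>i\<in>UNIV. lam $ i * exp (f t * \<theta> $ i)) \<longlongrightarrow> (\<Sum>i\<in>UNIV. lam $ i * exp (0 * \<theta> $ i))) at_top"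
      by (intro tendsto_intros f)
    then have "((\<lambda>t. vsum (exp_tilt lam (f t *\<^sub>R \<theta>))) \<longlongrightarrow> vsum (exp_tilt lam 0)) at_top"
      by (simp add: vsum_def exp_tilt_def)
    moreover have "filterlim (\<lambda>t::real. t powr \<nu>) at_top at_top"
    proof (rule filterlim_mono_eventually[OF _ order_refl order_refl])
      show "filterlim (\<lambda>t::real. exp (\<nu> * ln t)) at_top at_top"
        by (intro filterlim_compose[OF exp_at_top] filterlim_tendsto_pos_mult_at_top[OF tendsto_const \<nu>(1)] ln_at_top)
      show "\<forall>\<^sub>F t in at_top. exp (\<nu> * ln t) = t powr \<nu>"
        using eventually_gt_at_top[of "0::real"] by eventually_elim (simp add: powr_def)
    qed
    ultimately have "filterlim (\<lambda>t. tilted_argument (f t *\<^sub>R \<theta>) t) at_top at_top"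
      unfolding tilted_argument_def 
      by (rule filterlim_tendsto_pos_mult_at_top[OF _ vsum_exp_tilt_pos[OF lam]])
    then show ?thesis by (simp add: filterlim_at_top)
  qed
  have power: "tilted_argument \<eta> t powr (1 / \<nu>) = t * vsum (exp_tilt lam \<eta>) powr (1 / \<nu>)"
    if "0 < t" for \<eta> t
    using that \<nu> vsum_exp_tilt_pos[OF lam, of \<eta>]
    by (simp add: tilted_argument_def powr_mult powr_powr)
  show ?thesis
  proof (intro exI allI impI)
    fix f :: "real \<Rightarrow> real" assume f: "(f \<longlongrightarrow> 0) at_top"
    show "\<forall>\<^sub>F t in at_top. \<bar>log_mgf (f t *\<^sub>R \<theta>) t - t * (vsum (exp_tilt lam (f t *\<^sub>R \<theta>)) powr (1 / \<nu>)
      - vsum (exp_tilt lam (0 *\<^sub>R \<theta>)) powr (1 / \<nu>))\<bar> \<le> 2 * K"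
      using large[OF f] large[OF tendsto_const] eventually_gt_at_top[of "0::real"]
    proof eventually_elim
      case (elim t)
      have "t * (vsum (exp_tilt lam (f t *\<^sub>R \<theta>)) powr (1 / \<nu>) - vsum (exp_tilt lam (0 *\<^sub>R \<theta>)) powr (1 / \<nu>))
          = tilted_argument (f t *\<^sub>R \<theta>) t powr (1 / \<nu>) - tilted_argument 0 t powr (1 / \<nu>)"
        using power elim by (simp add: right_diff_distrib)
      then show ?case
        using K[OF elim(1)] K[OF elim(2)] by (simp add: log_mgf_def)
    qed
  qed
qed

definition rescaled :: "(real \<Rightarrow> real) \<Rightarrow> real \<Rightarrow> 'w \<Rightarrow> real ^ 'm"
  where "rescaled a t \<omega> =
    sqrt (t * a t) *\<^sub>R ((1 / t) *\<^sub>R (real_vec (M t \<omega>) - mean_vec P (M t)))"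

context
  fixes a :: "real \<Rightarrow> real"
  assumes a_pos: "\<And>t. 0 < t \<Longrightarrow> 0 < a t" and a_lim: "(a \<longlongrightarrow> 0) at_top"
    and ta_lim: "filterlim (\<lambda>t. t * a t) at_top at_top"
begin

lemma inner_rescaled:
  assumes t: "0 < t"
  shows "1 / a t * (\<theta> \<bullet> rescaled a t \<omega>)
    = (1 / sqrt (t * a t)) *\<^sub>R \<theta> \<bullet> real_vec (M t \<omega>) - 1 / sqrt (t * a t) * (\<theta> \<bullet> mean_vec P (M t))"
proof -
  have "1 / a t * (sqrt (t * a t) * (1 / t)) = sqrt (t * a t) / (t * a t)" by simp
  also have "\<dots> = 1 / sqrt (t * a t)"
    using t a_pos[OF t] real_sqrt_mult_self[of "t * a t"] by (simp add: field_simps)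
  finally have "1 / a t * (sqrt (t * a t) * (1 / t)) = 1 / sqrt (t * a t)" .
  moreover have "1 / a t * (\<theta> \<bullet> rescaled a t \<omega>)
      = 1 / a t * (sqrt (t * a t) * (1 / t)) * (\<theta> \<bullet> (real_vec (M t \<omega>) - mean_vec P (M t)))"
    by (simp add: rescaled_def)
  ultimately show ?thesis by (simp add: inner_diff_right right_diff_distrib)
qed

lemma rescaled_mgf:
  assumes t: "0 < t"
  shows "integrable P (\<lambda>\<omega>. exp (1 / a t * (\<theta> \<bullet> rescaled a t \<omega>)))"
    and "expectation (\<lambda>\<omega>. exp (1 / a t * (\<theta> \<bullet> rescaled a t \<omega>)))
      = exp (log_mgf ((1 / sqrt (t * a t)) *\<^sub>R \<theta>) t - 1 / sqrt (t * a t) * (\<theta> \<bullet> mean_vec P (M t)))"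
proof -
  show "integrable P (\<lambda>\<omega>. exp (1 / a t * (\<theta> \<bullet> rescaled a t \<omega>)))"
    unfolding inner_rescaled[OF t] exp_diff by (intro integrable_divide mgf t)
  show "expectation (\<lambda>\<omega>. exp (1 / a t * (\<theta> \<bullet> rescaled a t \<omega>)))
      = exp (log_mgf ((1 / sqrt (t * a t)) *\<^sub>R \<theta>) t - 1 / sqrt (t * a t) * (\<theta> \<bullet> mean_vec P (M t)))"
    unfolding inner_rescaled[OF t] exp_diff
    using mgf(2)[OF t, of "(1 / sqrt (t * a t)) *\<^sub>R \<theta>"] by simp
qed

lemma rescaled_log_mgf_limit:
  "((\<lambda>t. ln (expectation (\<lambda>\<omega>. exp (1 / a t * (\<theta> \<bullet> rescaled a t \<omega>)))) / (1 / a t))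
    \<longlongrightarrow> Lambda_tilde \<nu> lam \<theta>) at_top"
proof -
  let ?\<psi> = "\<lambda>x. vsum (exp_tilt lam (x *\<^sub>R \<theta>)) powr (1 / \<nu>)"
  obtain K where K: "\<And>f. (f \<longlongrightarrow> 0) at_top \<Longrightarrow> \<forall>\<^sub>F t in at_top.
      \<bar>log_mgf (f t *\<^sub>R \<theta>) t - t * (?\<psi> (f t) - ?\<psi> 0)\<bar> \<le> K"
    using log_mgf_asymp[of \<theta>] by blast
  obtain d where d: "((\<lambda>x. (?\<psi> x - ?\<psi> 0 - x * d) / x\<^sup>2) \<longlongrightarrow> Lambda_tilde \<nu> lam \<theta>) (at 0)"
    using tilted_total_rate_second_order[OF lam] .
  have "((\<lambda>t. a t * (log_mgf ((1 / sqrt (t * a t)) *\<^sub>R \<theta>) t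
      - 1 / sqrt (t * a t) * (\<theta> \<bullet> mean_vec P (M t)))) \<longlongrightarrow> Lambda_tilde \<nu> lam \<theta>) at_top"
  proof (rule moderate_scaling_of_log_mgf[where l = "\<lambda>t x. log_mgf (x *\<^sub>R \<theta>) t" and \<psi> = ?\<psi> and a = a])
    show "x * (\<theta> \<bullet> mean_vec P (M t)) \<le> log_mgf (x *\<^sub>R \<theta>) t" if "0 < t" for t x
      using inner_mean_vec_le_log_mgf[OF that, of "x *\<^sub>R \<theta>"] by simp
  qed (use K d a_pos a_lim ta_lim in auto)
  moreover have "\<forall>\<^sub>F t in at_top. a t * (log_mgf ((1 / sqrt (t * a t)) *\<^sub>R \<theta>) t
      - 1 / sqrt (t * a t) * (\<theta> \<bullet> mean_vec P (M t)))
    = ln (expectation (\<lambda>\<omega>. exp (1 / a t * (\<theta> \<bullet> rescaled a t \<omega>)))) / (1 / a t)"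
    using eventually_gt_at_top[of "0::real"]
    by eventually_elim (simp only: rescaled_mgf(2) ln_exp, simp)
  ultimately show ?thesis by (rule Lim_transform_eventually)
qed

lemma moderate_deviations:
  shows "satisfies_LDP P (rescaled a) (\<lambda>t. 1 / a t) (legendre_transform (Lambda_tilde \<nu> lam))"
    and "good_rate_function (legendre_transform (Lambda_tilde \<nu> lam))"
proof -
  interpret exponential_family_limit P "rescaled a" "\<lambda>t. 1 / a t" "Lambda_tilde \<nu> lam"
  proof
    show "rescaled a t \<in> borel_measurable P" if "0 < t" for t
      unfolding rescaled_def by (rule M_measurable[OF that])
    show "0 < 1 / a t" if "0 < t" for t using a_pos[OF that] by simp
    have "\<forall>\<^sub>F t in at_top. 0 < a t \<and> a t \<noteq> 0"
      using eventually_gt_at_top[of "0::real"]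
      by eventually_elim (use a_pos in \<open>force dest: less_imp_neq\<close>)
    then have "filterlim a (at_right 0) at_top"
      using a_lim by (simp add: filterlim_at)
    then show "filterlim (\<lambda>t. 1 / a t) at_top at_top"
      using filterlim_compose[OF filterlim_inverse_at_top_right] by (simp add: inverse_eq_divide)
    show "integrable P (\<lambda>\<omega>. exp (1 / a t * (\<theta> \<bullet> rescaled a t \<omega>)))" if "0 < t" for \<theta> t
      by (rule rescaled_mgf(1)[OF that])
    show "((\<lambda>t. ln (expectation (\<lambda>\<omega>. exp (1 / a t * (\<theta> \<bullet> rescaled a t \<omega>)))) / (1 / a t))
      \<longlongrightarrow> Lambda_tilde \<nu> lam \<theta>) at_top" for \<theta>
      by (rule rescaled_log_mgf_limit)
  qed
  have "\<exists>\<eta>. (Lambda_tilde \<nu> lam has_derivative (\<lambda>h. h \<bullet> x)) (at \<eta>)" for x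
  proof -
    obtain \<eta> where "x = cov_matrix \<nu> lam *v \<eta>" using surjD[OF surj_cov_matrix[OF \<nu> lam]] by blast
    then show ?thesis using Lambda_tilde_has_derivative by blast
  qed
  from gaertner_ellis[OF this]
  show "satisfies_LDP P (rescaled a) (\<lambda>t. 1 / a t) (legendre_transform (Lambda_tilde \<nu> lam))"
    and "good_rate_function (legendre_transform (Lambda_tilde \<nu> lam))" .
qed

end

end

theorem proposition2:
  fixes P :: "'w measure" and \<nu> :: real and lam :: "real ^ 'm::finite"
    and M :: "real \<Rightarrow> 'w \<Rightarrow> nat ^ 'm" and a :: "real \<Rightarrow> real"
  assumes "0 < \<nu>" and "\<nu> \<le> 1"
    and "\<And>i. 0 < lam $ i"
    and "alt_frac_poisson_process P \<nu> lam M"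
    and "\<And>t. 0 < t \<Longrightarrow> 0 < a t"
    and "(a \<longlongrightarrow> 0) at_top"
    and "filterlim (\<lambda>t. t * a t) at_top at_top"
  shows "satisfies_LDP P
      (\<lambda>t \<omega>. sqrt (t * a t) *\<^sub>R ((1 / t) *\<^sub>R (real_vec (M t \<omega>) - mean_vec P (M t))))
      (\<lambda>t. 1 / a t)
      (legendre_transform (Lambda_tilde \<nu> lam))
    \<and> good_rate_function (legendre_transform (Lambda_tilde \<nu> lam))"
proof -
  interpret alt_frac_poisson P \<nu> lam M
    using assms(1-4) by unfold_locales
  show ?thesis
    using moderate_deviations[OF assms(5-7)] by (simp only: rescaled_def[abs_def])
qed

end
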